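(* Consider the problem of minimizing $\phi(x)=\mathbb{E}_\xi[F(x,\xi)]+\Psi(x)$ over $x\in\mathbb{R}^n$, and write $f(x)=\mathbb{E}_\xi[F(x,\xi)]$. Assume that: for each $\xi\in\Xi$, $\|\nabla_xF(y,\xi)-\nabla_xF(z,\xi)\|_*\le L\|y-z\|$ for all $y,z\in\mathbb{R}^n$; $\mathbb{E}_\xi[\|\nabla_xF(x,\xi)-\nabla f(x)\|_*^2]\le\sigma^2$ for all $x\in\mathbb{R}^n$, where $\sigma\ge 0$; $\Psi$ is proper, convex and lower semicontinuous with closed effective domain; $\Psi$ is $\mu_\Psi$-strongly convex with respect to $\|\cdot\|$ for some $\mu_\Psi>0$; and there is $Q\ge1$ such that $D_\omega(x,y)\le\frac Q2\|x-y\|^2$ for all $x,y\in\mathrm{dom}\,\Psi$. Let $x^\star$ be the unique minimizer of $\phi$. Let $\{x(k)\}_{k\ge 0}$ be the iterates of the asynchronous mini-batch algorithm described in the context, with batch size $b$, delays bounded by $\tau_{\max}$, and step-sizes $$\gamma(k)^{-1}=2L(\tau_{\max}+1)^2+\beta(k),\qquad\beta(k)=\frac{\mu_\Psi}{3Q}\bigl(k+\tau_{\max}+1\bigr),\qquad k\in\mathbb{N}_0.$$ Then for all $T\in\mathbb{N}$ (with $T\ge1$), $$\mathbb{E}\bigl[\|x(T)-x^\star\|^2\bigr]\le\frac{2\left(\frac{6LQ}{\mu_\Psi}+1\right)^2(\tau_{\max}+1)^4}{(T+1)^2}D_\omega(x(0),x^\star)+\frac{18c\sigma^2Q^2}{b\mu_\Psi^2(T+1)},$$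 where $c\in[1,b]$ is given by $c=1$ if $\|\cdot\|_*=\|\cdot\|_2$ and $c=2\max_{\|x\|\le1}\omega(x)$ otherwise.
   Context: Norms: $\mathbb{R}^n$ carries a norm $\|\cdot\|$ with dual norm $\|y\|_*=\sup_{\|x\|\le1}\langle x,y\rangle$; $\|\cdot\|_2$ is the Euclidean norm. $\mathbb{N}_0=\mathbb{N}\cup\{0\}$. Problem data: $\xi$ is a random vector with distribution $\mathcal{P}$ supported on $\Xi\subseteq\mathbb{R}^m$; $F(\cdot,\xi)$ is convex and differentiable on $\mathbb{R}^n$ for each $\xi\in\Xi$; $\Psi:\mathbb{R}^n\to\mathbb{R}\cup\{+\infty\}$ is a proper convex function with effective domain $\mathrm{dom}\,\Psi=\{x:\Psi(x)<+\infty\}$. The function $f$ is finite, convex and differentiable, with $\nabla f(x)=\mathbb{E}_\xi[\nabla_xF(x,\xi)]$. $\Psi$ is $\mu_\Psi$-strongly convex with respect to $\|\cdot\|$ if for all $x,y\in\mathrm{dom}\,\Psi$ and all subgradients $s\in\partial\Psi(x)$, $\Psi(y)\ge\Psi(x)+\langle s,y-x\rangle+\frac{\mu_\Psi}2\|y-x\|^2$. Strong convexity of $\Psi$ ensures that $\phi$ has a unique minimizer. Bregman distance: $\omega:X\to\mathbb{R}$, with $\mathrm{dom}\,\Psi\subseteq X\subseteq\mathbb{R}^n$, is a distance generating function with modulus $1$, i.e. $\omega$ is continuously differentiable and $\omega(y)\ge\omega(x)+\langle\nabla\omega(x),y-x\rangle+\frac12\|y-x\|^2$ for all $x,y\in X$.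 Its Bregman distance is $D_\omega(x,y)=\omega(y)-\omega(x)-\langle\nabla\omega(x),y-x\rangle$. When the second formula for $c$ is used, $\omega$ is taken to be defined and $1$-strongly convex with respect to $\|\cdot\|$ on all of $\mathbb{R}^n$. The constant $c$ is taken to satisfy $1\le c\le b$. Algorithm: start from a deterministic $x(0)\in\mathrm{dom}\,\Psi$, with batch size $b\in\mathbb{N}$ and positive step-sizes $\gamma(k)$. The delays are given by integers $d(k)$ with $0\le d(k)\le k$ and $\tau(k):=k-d(k)\le\tau_{\max}$ for all $k\in\mathbb{N}_0$, where $\tau_{\max}$ is a nonnegative integer; the $d(k)$ are a fixed sequence. The samples $\xi_i(k)$ ($i=1,\dots,b$, $k\in\mathbb{N}_0$) are i.i.d. from $\mathcal{P}$. At update $k$, using the batch $\xi_1(k),\dots,\xi_b(k)$, $$g_{\mathrm{ave}}(d(k))=\frac1b\sum_{i=1}^b\nabla_xF\bigl(x(d(k)),\xi_i(k)\bigr),\qquad x(k+1)=\operatorname*{argmin}_z\Bigl\{\langle g_{\mathrm{ave}}(d(k)),z\rangle+\Psi(z)+\frac1{\gamma(k)}D_\omega(x(k),z)\Bigr\}.$$ Thus $x(k)$ is a function of the samples $\xi_i(t)$ with $t\le k-1$ only. The expectation in the claim is over all samples $\xi_i(k)$, $i=1,\dots,b$, $k=0,\dots,T-1$. *)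

theory Defs
  imports "HOL-Probability.Probability"
begin

definition is_norm :: "('a::real_vector \<Rightarrow> real) \<Rightarrow> bool" where
  "is_norm N \<longleftrightarrow>
     (\<forall>x. 0 \<le> N x) \<and> (\<forall>x. N x = 0 \<longleftrightarrow> x = 0) \<and>
     (\<forall>a x. N (a *\<^sub>R x) = \<bar>a\<bar> * N x) \<and> (\<forall>x y. N (x + y) \<le> N x + N y)"

definition dual_norm :: "('a::real_inner \<Rightarrow> real) \<Rightarrow> 'a \<Rightarrow> real" where
  "dual_norm N y = (SUP x\<in>{x. N x \<le> 1}. x \<bullet> y)"


definition eff_dom :: "('a \<Rightarrow> ereal) \<Rightarrow> 'a set" where
  "eff_dom \<Psi> = {x. \<Psi> x < \<infinity>}"

definition proper_fun :: "('a \<Rightarrow> ereal) \<Rightarrow> bool" where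
  "proper_fun \<Psi> \<longleftrightarrow> eff_dom \<Psi> \<noteq> {} \<and> (\<forall>x. \<Psi> x \<noteq> -\<infinity>)"

definition convex_fun :: "('a::real_vector \<Rightarrow> ereal) \<Rightarrow> bool" where
  "convex_fun \<Psi> \<longleftrightarrow>
     (\<forall>x y u v. 0 \<le> u \<longrightarrow> 0 \<le> v \<longrightarrow> u + v = 1 \<longrightarrow>
        \<Psi> (u *\<^sub>R x + v *\<^sub>R y) \<le> ereal u * \<Psi> x + ereal v * \<Psi> y)"

definition lower_semicont :: "('a::topological_space \<Rightarrow> ereal) \<Rightarrow> bool" where
  "lower_semicont \<Psi> \<longleftrightarrow> (\<forall>x. \<Psi> x \<le> Liminf (at x) \<Psi>)"

definition subdifferential :: "('a::real_inner \<Rightarrow> ereal) \<Rightarrow> 'a \<Rightarrow> 'a set" where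
  "subdifferential \<Psi> x = {s. \<forall>y. \<Psi> y \<ge> \<Psi> x + ereal (s \<bullet> (y - x))}"

definition strongly_convex_fun ::
    "('a::real_inner \<Rightarrow> real) \<Rightarrow> real \<Rightarrow> ('a \<Rightarrow> ereal) \<Rightarrow> bool" where
  "strongly_convex_fun N \<mu> \<Psi> \<longleftrightarrow>
     (\<forall>x\<in>eff_dom \<Psi>. \<forall>y\<in>eff_dom \<Psi>. \<forall>s\<in>subdifferential \<Psi> x.
        \<Psi> y \<ge> \<Psi> x + ereal (s \<bullet> (y - x)) + ereal (\<mu> / 2 * (N (y - x))\<^sup>2))"


text \<open>A function on a set \<open>X\<close> is represented by a total function whose values outside \<open>X\<close> are
  irrelevant. The gradient \<open>\<omega>'\<close> is passed explicitly; since \<open>X\<close> need not be open, it is a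
  gradient relative to \<open>X\<close>.\<close>

definition distance_generating ::
    "('a::real_inner \<Rightarrow> real) \<Rightarrow> 'a set \<Rightarrow> ('a \<Rightarrow> real) \<Rightarrow> ('a \<Rightarrow> 'a) \<Rightarrow> bool" where
  "distance_generating N X \<omega> \<omega>' \<longleftrightarrow>
     (\<forall>x\<in>X. (\<omega> has_derivative (\<lambda>h. h \<bullet> \<omega>' x)) (at x within X)) \<and>
     continuous_on X \<omega>' \<and>
     (\<forall>x\<in>X. \<forall>y\<in>X. \<omega> y \<ge> \<omega> x + \<omega>' x \<bullet> (y - x) + 1 / 2 * (N (y - x))\<^sup>2)"

definition bregman :: "('a::real_inner \<Rightarrow> real) \<Rightarrow> ('a \<Rightarrow> 'a) \<Rightarrow> 'a \<Rightarrow> 'a \<Rightarrow> real" where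
  "bregman \<omega> \<omega>' x y = \<omega> y - \<omega> x - \<omega>' x \<bullet> (y - x)"

text \<open>The supremum below is a maximum whenever \<open>\<omega>\<close> is continuous, since the unit ball of a norm
  on a Euclidean space is compact.\<close>

definition variance_const :: "('a::real_inner \<Rightarrow> real) \<Rightarrow> ('a \<Rightarrow> real) \<Rightarrow> real" where
  "variance_const N \<omega> =
     (if dual_norm N = norm then 1 else 2 * (SUP x\<in>{x. N x \<le> 1}. \<omega> x))"


definition batch_grad ::
    "('a::real_vector \<Rightarrow> 'b \<Rightarrow> 'a) \<Rightarrow> nat \<Rightarrow> (nat \<Rightarrow> 'b) \<Rightarrow> 'a \<Rightarrow> 'a" where
  "batch_grad F' b s y = (1 / real b) *\<^sub>R (\<Sum>i=1..b. F' y (s i))"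

text \<open>The sequence \<open>x\<close> is a run of the algorithm on the sample path \<open>s\<close>, where \<open>s i k\<close> is the
  \<open>i\<close>-th sample of the batch used in update \<open>k\<close>. Outside the effective domain of \<open>\<Psi>\<close> the
  minimised function is infinite, whatever the value of the Bregman distance.\<close>

definition async_minibatch_run ::
    "('a::real_inner \<Rightarrow> 'b \<Rightarrow> 'a) \<Rightarrow> ('a \<Rightarrow> ereal) \<Rightarrow> ('a \<Rightarrow> real) \<Rightarrow> ('a \<Rightarrow> 'a) \<Rightarrow>
     nat \<Rightarrow> (nat \<Rightarrow> real) \<Rightarrow> (nat \<Rightarrow> nat) \<Rightarrow> 'a \<Rightarrow> (nat \<Rightarrow> nat \<Rightarrow> 'b) \<Rightarrow> (nat \<Rightarrow> 'a) \<Rightarrow> bool" where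
  "async_minibatch_run F' \<Psi> \<omega> \<omega>' b \<gamma> d x0 s x \<longleftrightarrow>
     x 0 = x0 \<and>
     (\<forall>k. is_arg_min
        (\<lambda>z. ereal (batch_grad F' b (\<lambda>i. s i k) (x (d k)) \<bullet> z) + \<Psi> z
              + ereal (1 / \<gamma> k * bregman \<omega> \<omega>' (x k) z))
        (\<lambda>z. True) (x (Suc k)))"

end

theory Submission
  imports Defs
begin

text \<open>
  Write \<open>a k = 1 / \<gamma> k\<close>, \<open>p = \<mu> / Q\<close>, \<open>V k = D (x k) xstar\<close>, and \<open>e\<close> for the error of the batch
  gradient at the delayed point \<open>x (d k)\<close>. Optimality of the step, strong convexity of \<open>\<Psi>\<close> at the
  new iterate, the quadratic upper and linear lower bounds of \<open>f\<close> at \<open>x (d k)\<close>, and minimality of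
  \<open>xstar\<close> combine to
    \<open>(a k + p) V (k+1) \<le> a k V k + L/2 N(x (k+1) - x (d k))^2
       - a k D (x k) (x (k+1)) - e \<bullet> (x (k+1) - xstar)\<close>,
  where \<open>p V (k+1)\<close> comes from \<open>\<mu>/2 N(x (k+1) - xstar)^2\<close> through \<open>D \<le> Q/2 N^2\<close>. One half of
  \<open>a k D (x k) (x (k+1))\<close> pays for the delay and the other half for the noise.

  Multiplying by \<open>a k\<close> makes the recursion telescope, since \<open>a (k+1)^2 \<le> a k (a k + p)\<close>. The delay
  term is spread over the steps \<open>j\<close> between \<open>d k\<close> and \<open>k\<close>; each step receives at most \<open>\<tau>max + 1\<close>
  such contributions, and \<open>2 L (\<tau>max + 1)^2 a k \<le> a j^2\<close> for \<open>j \<le> k \<le> j + \<tau>max\<close>, so the half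
  reserved for it suffices. This is \<open>delayed_weighted_recursion\<close>, which leaves
    \<open>a T^2 V T \<le> a 0^2 V 0 + (\<Sum>k<T. a k * noise k)\<close>.

  The delicate part is the expectation of the noise. Bounding \<open>e \<bullet> (x (k+1) - x k)\<close> by Young's
  inequality would leave the second moment of the dual norm of a sum of independent vectors, and in a
  non-Euclidean norm variances do not simply add. Maximising over the new iterate instead gives an
  increment of the convex conjugate \<open>W\<close> of \<open>\<omega>\<close>, evaluated at \<open>\<omega>' (x k)\<close> and displaced by a multiple of
  \<open>e\<close>. Strong convexity of \<open>\<omega>\<close> makes \<open>W\<close> smooth with constant 1 in the dual norm. Adding the samples of
  the batch one at a time, each displacement contributes a first-order term, which has mean zero
  because the sample is independent of everything before it, and half its squared dual norm. Hence
  the variances do add (\<open>dual_potential_noise_bound\<close>, \<open>noise_expectation\<close>): the expectation of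
  \<open>a k * noise k\<close> is at most \<open>\<sigma>^2 / b\<close>, in every norm, and this is at most \<open>c \<sigma>^2 / b\<close> as \<open>1 \<le> c\<close>.
  When the dual norm is Euclidean, \<open>\<omega>\<close> may live on a subset only, and \<open>W\<close> is half the squared norm.

  The independence argument needs \<open>x k\<close> to be measurable with respect to the samples drawn before step
  \<open>k\<close>. This holds because \<open>x (k+1)\<close> is a Lipschitz function of the averaged gradient minus
  \<open>a k *\<^sub>R \<omega>' (x k)\<close>.
  Inserting the values of \<open>a 0\<close> and \<open>a T\<close> gives the rate.
\<close>

section \<open>Norms on Euclidean space and their duals\<close>

lemma is_norm_zero: "is_norm N \<Longrightarrow> N 0 = 0"
  unfolding is_norm_def by blast

lemma is_norm_nonneg: "is_norm N \<Longrightarrow> 0 \<le> N x"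
  unfolding is_norm_def by blast

lemma is_norm_scaleR: "is_norm N \<Longrightarrow> N (a *\<^sub>R x) = \<bar>a\<bar> * N x"
  unfolding is_norm_def by blast

lemma is_norm_triangle: "is_norm N \<Longrightarrow> N (x + y) \<le> N x + N y"
  unfolding is_norm_def by blast

lemma is_norm_minus_commute: "is_norm N \<Longrightarrow> N (x - y) = N (y - x)"
  using is_norm_scaleR[of N "-1" "x - y"] by simp

lemma is_norm_sum:
  assumes "is_norm N"
  shows "N (\<Sum>i\<in>I. g i) \<le> (\<Sum>i\<in>I. N (g i))"
proof (induction I rule: infinite_finite_induct)
  case (insert i I)
  then show ?case using is_norm_triangle[OF assms, of "g i" "sum g I"] by simp
qed (simp_all add: is_norm_zero[OF assms])

text \<open>The lower constant is the minimum of \<open>N\<close> on the compact unit sphere.\<close>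

lemma is_norm_equivalent_norm:
  fixes N :: "'a::euclidean_space \<Rightarrow> real"
  assumes N: "is_norm N"
  obtains m K where "0 < m" "0 < K" "\<And>x. m * norm x \<le> N x" "\<And>x. N x \<le> K * norm x"
proof -
  define K where "K = 1 + (\<Sum>b\<in>Basis. N (b::'a))"
  have K: "0 < K"
    unfolding K_def using is_norm_nonneg[OF N] by (simp add: add_pos_nonneg sum_nonneg)
  have up: "N x \<le> K * norm x" for x
  proof -
    have "N x = N (\<Sum>b\<in>Basis. (x \<bullet> b) *\<^sub>R b)" by (simp add: euclidean_representation)
    also have "\<dots> \<le> (\<Sum>b\<in>Basis. N ((x \<bullet> b) *\<^sub>R b))" by (rule is_norm_sum[OF N])
    also have "\<dots> = (\<Sum>b\<in>Basis. \<bar>x \<bullet> b\<bar> * N b)" by (simp add: is_norm_scaleR[OF N])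
    also have "\<dots> \<le> (\<Sum>b\<in>Basis. norm x * N b)"
      by (intro sum_mono mult_right_mono is_norm_nonneg[OF N] Basis_le_norm)
    also have "\<dots> \<le> K * norm x" unfolding K_def by (simp add: algebra_simps sum_distrib_left)
    finally show ?thesis .
  qed
  have "\<bar>N x - N y\<bar> \<le> K * norm (x - y)" for x y
    using is_norm_triangle[OF N, of "x - y" y] is_norm_triangle[OF N, of "y - x" x]
      is_norm_minus_commute[OF N, of x y] up[of "x - y"] by (simp add: abs_le_iff)
  then have "K-lipschitz_on UNIV N" using K by (intro lipschitz_onI) (auto simp: dist_norm)
  then have cont: "continuous_on (sphere 0 1) N"
    by (meson continuous_on_subset lipschitz_on_continuous_on subset_UNIV)
  obtain u where u: "u \<in> sphere 0 1" "\<And>v. v \<in> sphere 0 1 \<Longrightarrow> N u \<le> N v"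
    using continuous_attains_inf[OF compact_sphere _ cont] by auto
  have "u \<noteq> 0" using u by auto
  then have "N u \<noteq> 0" using N unfolding is_norm_def by blast
  then have pos: "0 < N u" using is_norm_nonneg[OF N, of u] by simp
  have low: "N u * norm x \<le> N x" for x
  proof (cases "x = 0")
    case False
    have "N u \<le> N ((1 / norm x) *\<^sub>R x)" using False by (intro u) simp
    then show ?thesis using False by (simp add: is_norm_scaleR[OF N] field_simps)
  qed (simp add: is_norm_zero[OF N])
  show ?thesis using that[OF pos K low up] .
qed

lemma continuous_on_is_norm:
  fixes N :: "'a::euclidean_space \<Rightarrow> real"
  assumes N: "is_norm N"
  shows "continuous_on S N"
proof -
  obtain m K where K: "0 < m" "0 < K" "\<And>x. m * norm x \<le> N x" "\<And>x. N x \<le> K * norm x"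
    using is_norm_equivalent_norm[OF N] by metis
  have "\<bar>N x - N y\<bar> \<le> K * norm (x - y)" for x y
    using is_norm_triangle[OF N, of "x - y" y] is_norm_triangle[OF N, of "y - x" x]
      is_norm_minus_commute[OF N, of x y] K(4)[of "x - y"] by (simp add: abs_le_iff)
  then have "K-lipschitz_on S N" using K by (intro lipschitz_onI) (auto simp: dist_norm)
  then show ?thesis by (rule lipschitz_on_continuous_on)
qed

context
  fixes N :: "'a::euclidean_space \<Rightarrow> real"
  assumes N: "is_norm N"
begin

lemma bdd_above_dual_norm: "bdd_above ((\<lambda>x. x \<bullet> y) ` {x. N x \<le> 1})"
proof -
  obtain m K where m: "0 < m" "\<And>x. m * norm x \<le> N x"
    using is_norm_equivalent_norm[OF N] by metis
  have "x \<bullet> y \<le> 1 / m * norm y" if "N x \<le> 1" for x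
  proof -
    have "norm x \<le> 1 / m" using m(1) m(2)[of x] that by (simp add: field_simps)
    then have "norm x * norm y \<le> 1 / m * norm y" by (rule mult_right_mono) simp
    then show ?thesis using norm_cauchy_schwarz[of x y] by linarith
  qed
  then show ?thesis by (intro bdd_aboveI2) auto
qed

lemma dual_norm_nonneg: "0 \<le> dual_norm N y"
  unfolding dual_norm_def
  using cSUP_upper[OF _ bdd_above_dual_norm, of 0 y] by (simp add: is_norm_zero[OF N])

lemma inner_le_dual_norm: "x \<bullet> y \<le> N x * dual_norm N y"
proof (cases "x = 0")
  case False
  then have "N x \<noteq> 0" using N unfolding is_norm_def by blast
  then have pos: "0 < N x" using is_norm_nonneg[OF N, of x] by simp
  have "((1 / N x) *\<^sub>R x) \<bullet> y \<le> dual_norm N y"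
    unfolding dual_norm_def using pos
    by (intro cSUP_upper bdd_above_dual_norm) (simp add: is_norm_scaleR[OF N])
  then show ?thesis using pos by (simp add: field_simps)
qed (simp add: is_norm_zero[OF N])

lemma dual_norm_least:
  assumes "\<And>x. N x \<le> 1 \<Longrightarrow> x \<bullet> y \<le> B"
  shows "dual_norm N y \<le> B"
proof -
  have "{x. N x \<le> 1} \<noteq> {}" using is_norm_zero[OF N] by (metis empty_iff mem_Collect_eq zero_le_one)
  then show ?thesis unfolding dual_norm_def using assms by (intro cSUP_least) auto
qed

lemma dual_norm_triangle: "dual_norm N (y + z) \<le> dual_norm N y + dual_norm N z"
proof (rule dual_norm_least)
  fix x assume x: "N x \<le> 1"
  have "x \<bullet> u \<le> dual_norm N u" for u
    using inner_le_dual_norm[of x u] mult_right_mono[OF x dual_norm_nonneg[of u]] by simp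
  from this[of y] this[of z] show "x \<bullet> (y + z) \<le> dual_norm N y + dual_norm N z"
    by (simp add: inner_add_right)
qed

lemma dual_norm_minus: "dual_norm N (- y) = dual_norm N y"
proof -
  have le: "dual_norm N (- u) \<le> dual_norm N u" for u
  proof (rule dual_norm_least)
    fix x assume x: "N x \<le> 1"
    have "N (- x) \<le> 1" using is_norm_scaleR[OF N, of "-1" x] x by simp
    then have "N (- x) * dual_norm N u \<le> 1 * dual_norm N u"
      by (rule mult_right_mono[OF _ dual_norm_nonneg])
    then show "x \<bullet> (- u) \<le> dual_norm N u" using inner_le_dual_norm[of "- x" u] by simp
  qed
  show ?thesis using le[of y] le[of "- y"] by simp
qed

lemma dual_norm_scaleR: "dual_norm N (a *\<^sub>R y) = \<bar>a\<bar> * dual_norm N y"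
proof -
  have le: "dual_norm N (a *\<^sub>R y) \<le> a * dual_norm N y" if "0 \<le> a" for a y
  proof (rule dual_norm_least)
    fix x assume x: "N x \<le> 1"
    have "x \<bullet> y \<le> dual_norm N y"
      using inner_le_dual_norm[of x y] mult_right_mono[OF x dual_norm_nonneg[of y]] by simp
    then show "x \<bullet> (a *\<^sub>R y) \<le> a * dual_norm N y" using that by (simp add: mult_left_mono)
  qed
  have eq: "dual_norm N (a *\<^sub>R y) = a * dual_norm N y" if "0 < a" for a y
    using le[of a y] le[of "1 / a" "a *\<^sub>R y"] that by (simp add: field_simps)
  have zero: "dual_norm N 0 = 0"
    using le[of 0 0] dual_norm_nonneg[of 0] by simp
  consider "a = 0" | "0 < a" | "0 < - a" by linarith
  then show ?thesis
  proof cases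
    case 3
    have "dual_norm N (a *\<^sub>R y) = dual_norm N ((- a) *\<^sub>R y)"
      using dual_norm_minus[of "a *\<^sub>R y"] by simp
    then show ?thesis using eq[OF 3, of y] 3 by simp
  qed (use zero eq in auto)
qed

lemma norm_le_dual_norm: obtains K where "0 < K" "\<And>y. norm y \<le> K * dual_norm N y"
proof -
  obtain m K where K: "0 < K" "\<And>x. N x \<le> K * norm x"
    using is_norm_equivalent_norm[OF N] by metis
  have "norm y \<le> K * dual_norm N y" for y
  proof (cases "y = 0")
    case False
    have "norm y * norm y \<le> N y * dual_norm N y"
      using inner_le_dual_norm[of y y] by (simp add: power2_norm_eq_inner flip: power2_eq_square)
    also have "\<dots> \<le> K * norm y * dual_norm N y"
      by (intro mult_right_mono K dual_norm_nonneg)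
    finally show ?thesis using False by simp
  qed (use K dual_norm_nonneg in simp)
  then show ?thesis using that K by blast
qed

lemma dual_norm_le_norm: obtains K where "0 < K" "\<And>y. dual_norm N y \<le> K * norm y"
proof -
  obtain m K where m: "0 < m" "\<And>x. m * norm x \<le> N x"
    using is_norm_equivalent_norm[OF N] by metis
  have "dual_norm N y \<le> 1 / m * norm y" for y
  proof (rule dual_norm_least)
    fix x assume "N x \<le> 1"
    then have "norm x \<le> 1 / m" using m(1) m(2)[of x] by (simp add: field_simps)
    then have "norm x * norm y \<le> 1 / m * norm y" by (rule mult_right_mono) simp
    then show "x \<bullet> y \<le> 1 / m * norm y" using norm_cauchy_schwarz[of x y] by linarith
  qed
  then show ?thesis using that[of "1 / m"] m(1) by simp
qed

lemma continuous_on_dual_norm: "continuous_on S (dual_norm N)"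
proof -
  obtain K where K: "0 < K" "\<And>y. dual_norm N y \<le> K * norm y"
    using dual_norm_le_norm by metis
  have "\<bar>dual_norm N x - dual_norm N y\<bar> \<le> K * norm (x - y)" for x y
    using dual_norm_triangle[of "x - y" y] dual_norm_triangle[of "y - x" x]
      dual_norm_minus[of "x - y"] K(2)[of "x - y"] by (simp add: abs_le_iff)
  then have "K-lipschitz_on S (dual_norm N)"
    using K by (intro lipschitz_onI) (auto simp: dist_norm)
  then show ?thesis by (rule lipschitz_on_continuous_on)
qed

lemma inner_le_half_squares: "v \<bullet> x \<le> 1 / 2 * (dual_norm N v)\<^sup>2 + 1 / 2 * (N x)\<^sup>2"
proof -
  have "v \<bullet> x \<le> dual_norm N v * N x"
    using inner_le_dual_norm[of x v] by (simp add: inner_commute mult.commute)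
  moreover have "0 \<le> (dual_norm N v - N x)\<^sup>2" by simp
  ultimately show ?thesis by (simp add: power2_diff)
qed

end

section \<open>Convexity, smoothness and the proximal step\<close>

text \<open>First-order conditions are all obtained from this one-sided comparison along a segment. It needs
  only a derivative relative to \<open>S\<close>, so that it also applies at boundary points of the domain of the
  regularizer.\<close>

lemma directional_derivative_lower_bound:
  fixes h :: "'a::real_inner \<Rightarrow> real"
  assumes deriv: "(h has_derivative (\<lambda>v. v \<bullet> g)) (at x within S)"
    and seg: "\<And>t. 0 \<le> t \<Longrightarrow> t \<le> 1 \<Longrightarrow> x + t *\<^sub>R (y - x) \<in> S"
    and low: "\<And>t. 0 < t \<Longrightarrow> t \<le> 1 \<Longrightarrow> h x + t * r \<le> h (x + t *\<^sub>R (y - x))"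
  shows "r \<le> g \<bullet> (y - x)"
proof -
  define p where "p = (\<lambda>t::real. x + t *\<^sub>R (y - x))"
  have p: "(p has_derivative (\<lambda>t. t *\<^sub>R (y - x))) (at 0 within {0..1})"
    unfolding p_def by (auto intro!: derivative_eq_intros)
  have "(h has_derivative (\<lambda>v. v \<bullet> g)) (at (p 0) within p ` {0..1})"
    using deriv seg by (intro has_derivative_subset[OF _ image_subsetI]) (auto simp: p_def)
  from diff_chain_within[OF p this]
  have "(h \<circ> p has_real_derivative g \<bullet> (y - x)) (at 0 within {0..1})"
    by (simp add: has_field_derivative_def o_def inner_commute mult_commute_abs)
  then have lim: "((\<lambda>t. (h (p t) - h (p 0)) / t) \<longlongrightarrow> g \<bullet> (y - x)) (at 0 within {0..1})"
    by (simp add: has_field_derivative_iff)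
  have ev: "\<forall>\<^sub>F t in at 0 within {0..1}. r \<le> (h (p t) - h (p 0)) / t"
    unfolding eventually_at
  proof (intro exI[of _ 1] conjI ballI impI)
    fix t :: real assume "t \<in> {0..1}" "t \<noteq> 0 \<and> dist t 0 < 1"
    then have "0 < t" "t \<le> 1" by auto
    with low[of t] show "r \<le> (h (p t) - h (p 0)) / t" by (simp add: p_def field_simps)
  qed simp
  have "at (0::real) within {0..1} \<noteq> bot"
    by (simp add: trivial_limit_within islimpt_Icc)
  then show ?thesis using tendsto_lowerbound[OF lim ev] by simp
qed

lemma convex_on_gradient_inequality:
  fixes h :: "'a::real_inner \<Rightarrow> real"
  assumes "convex_on UNIV h" and "GDERIV h x :> g"
  shows "h x + g \<bullet> (y - x) \<le> h y"
proof -
  have "h x - h y \<le> (- g) \<bullet> (y - x)"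
  proof (rule directional_derivative_lower_bound[where h = "\<lambda>z. - h z" and S = UNIV])
    show "((\<lambda>z. - h z) has_derivative (\<lambda>v. v \<bullet> - g)) (at x)"
      using GDERIV_minus[OF assms(2)] by (simp add: gderiv_def)
    fix t :: real assume t: "0 < t" "t \<le> 1"
    have "h ((1 - t) *\<^sub>R x + t *\<^sub>R y) \<le> (1 - t) * h x + t * h y"
      using t by (intro convex_onD[OF assms(1)]) auto
    then show "- h x + t * (h x - h y) \<le> - h (x + t *\<^sub>R (y - x))"
      by (simp add: algebra_simps)
  qed simp
  then show ?thesis by simp
qed

text \<open>Along the segment from \<open>z\<close> to \<open>y\<close>, the function minus its quadratic model has nonpositive
  derivative.\<close>

lemma descent_inequality:
  fixes h :: "'a::euclidean_space \<Rightarrow> real"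
  assumes N: "is_norm N" and L: "0 \<le> L"
    and grad: "\<And>y. GDERIV h y :> h' y"
    and smooth: "\<And>y z. dual_norm N (h' y - h' z) \<le> L * N (y - z)"
  shows "h y \<le> h z + h' z \<bullet> (y - z) + L / 2 * (N (y - z))\<^sup>2"
proof -
  define p where "p = (\<lambda>t::real. z + t *\<^sub>R (y - z))"
  define q where "q = (\<lambda>t. h (p t) - t * (h' z \<bullet> (y - z)) - L / 2 * (N (y - z))\<^sup>2 * t\<^sup>2)"
  have "q 1 \<le> q 0"
  proof (rule DERIV_nonpos_imp_nonincreasing[where f = q and a = 0 and b = 1])
    fix t :: real assume t: "0 \<le> t" "t \<le> 1"
    have p: "(p has_derivative (\<lambda>t. t *\<^sub>R (y - z))) (at t)"
      unfolding p_def by (auto intro!: derivative_eq_intros)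
    have "(h has_derivative (\<lambda>v. v \<bullet> h' (p t))) (at (p t))"
      using grad[of "p t"] by (simp add: gderiv_def)
    from diff_chain_at[OF p this]
    have hp: "((\<lambda>t. h (p t)) has_real_derivative (h' (p t) \<bullet> (y - z))) (at t)"
      by (simp add: has_field_derivative_def o_def inner_commute mult_commute_abs)
    have "(q has_real_derivative
        h' (p t) \<bullet> (y - z) - h' z \<bullet> (y - z) - L / 2 * (N (y - z))\<^sup>2 * (2 * t)) (at t)"
      unfolding q_def by (rule derivative_eq_intros hp refl | simp)+
    moreover have "h' (p t) \<bullet> (y - z) - h' z \<bullet> (y - z) - L / 2 * (N (y - z))\<^sup>2 * (2 * t) \<le> 0"
    proof -
      have "(h' (p t) - h' z) \<bullet> (y - z) \<le> N (y - z) * dual_norm N (h' (p t) - h' z)"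
        using inner_le_dual_norm[OF N] by (metis inner_commute)
      also have "\<dots> \<le> N (y - z) * (L * N (p t - z))"
        by (intro mult_left_mono smooth is_norm_nonneg[OF N])
      also have "N (p t - z) = t * N (y - z)"
        unfolding p_def using is_norm_scaleR[OF N] t by simp
      finally show ?thesis by (simp add: inner_diff_left power2_eq_square algebra_simps)
    qed
    ultimately show "\<exists>D. (q has_real_derivative D) (at t) \<and> D \<le> 0" by blast
  qed simp
  then show ?thesis by (simp add: q_def p_def)
qed

lemma bregman_three_points:
  "bregman \<omega> \<omega>' x y - bregman \<omega> \<omega>' x z - bregman \<omega> \<omega>' z y = (\<omega>' z - \<omega>' x) \<bullet> (y - z)"
  unfolding bregman_def by (simp add: algebra_simps)

lemma distance_generating_subset:
  "distance_generating N X \<omega> \<omega>' \<Longrightarrow> C \<subseteq> X \<Longrightarrow> distance_generating N C \<omega> \<omega>'"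
  unfolding distance_generating_def
  by (meson continuous_on_subset has_derivative_subset subset_iff)

lemma bregman_lower_bound:
  assumes "distance_generating N X \<omega> \<omega>'" "x \<in> X" "y \<in> X"
  shows "1 / 2 * (N (y - x))\<^sup>2 \<le> bregman \<omega> \<omega>' x y"
  using assms unfolding distance_generating_def bregman_def by fastforce

text \<open>\<open>C\<close> and \<open>\<psi>\<close> stand for the effective domain of the regularizer and its real values there; strong
  convexity is required only against subgradients, as in the extended-valued definition.\<close>

locale mirror_geometry =
  fixes N :: "'a::euclidean_space \<Rightarrow> real" and C :: "'a set" and \<psi> :: "'a \<Rightarrow> real"
    and \<mu> :: real and \<omega> :: "'a \<Rightarrow> real" and \<omega>' :: "'a \<Rightarrow> 'a"
  assumes N_norm: "is_norm N"
    and convex_C: "convex C"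
    and convex_\<psi>: "convex_on C \<psi>"
    and strong: "\<And>x y s. x \<in> C \<Longrightarrow> y \<in> C \<Longrightarrow> (\<And>z. z \<in> C \<Longrightarrow> \<psi> x + s \<bullet> (z - x) \<le> \<psi> z) \<Longrightarrow>
      \<psi> x + s \<bullet> (y - x) + \<mu> / 2 * (N (y - x))\<^sup>2 \<le> \<psi> y"
    and dgf: "distance_generating N C \<omega> \<omega>'"
    and \<mu>_nonneg: "0 \<le> \<mu>"
begin

abbreviation D :: "'a \<Rightarrow> 'a \<Rightarrow> real" where
  "D \<equiv> bregman \<omega> \<omega>'"

definition mirror_step :: "real \<Rightarrow> 'a \<Rightarrow> 'a \<Rightarrow> 'a \<Rightarrow> bool" where
  "mirror_step a g x z \<longleftrightarrow> z \<in> C \<and>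
     (\<forall>y\<in>C. g \<bullet> z + \<psi> z + a * D x z \<le> g \<bullet> y + \<psi> y + a * D x y)"

text \<open>The minimizer need not be interior and \<open>\<psi>\<close> need not be differentiable, so optimality takes the
  form of an explicit subgradient of \<open>\<psi>\<close>, found by moving from \<open>z\<close> towards \<open>y\<close>.\<close>

lemma mirror_step_optimality:
  assumes a: "0 < a" and step: "mirror_step a g x z" and y: "y \<in> C"
  shows "\<psi> z + (- g - a *\<^sub>R (\<omega>' z - \<omega>' x)) \<bullet> (y - z) \<le> \<psi> y"
proof -
  have z: "z \<in> C" and opt: "\<And>y. y \<in> C \<Longrightarrow> g \<bullet> z + \<psi> z + a * D x z \<le> g \<bullet> y + \<psi> y + a * D x y"
    using step unfolding mirror_step_def by auto
  \<comment> \<open>The rate at which \<open>\<omega>\<close> must grow from \<open>z\<close> towards \<open>y\<close> to offset the decrease of the other terms.\<close>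
  define r where "r = \<omega>' x \<bullet> (y - z) - (g \<bullet> (y - z) + \<psi> y - \<psi> z) / a"
  have ar: "a * r = a * (\<omega>' x \<bullet> (y - z)) - (g \<bullet> (y - z) + \<psi> y - \<psi> z)"
    using a by (simp add: r_def field_simps)
  have segment: "(1 - t) *\<^sub>R z + t *\<^sub>R y = z + t *\<^sub>R (y - z)" for t
    by (simp add: algebra_simps)
  have "r \<le> \<omega>' z \<bullet> (y - z)"
  proof (rule directional_derivative_lower_bound[where h = \<omega> and S = C])
    show "(\<omega> has_derivative (\<lambda>v. v \<bullet> \<omega>' z)) (at z within C)"
      using dgf z unfolding distance_generating_def by blast
    show in_C: "z + t *\<^sub>R (y - z) \<in> C" if "0 \<le> t" "t \<le> 1" for t
      using convexD_alt[OF convex_C z y that] by (simp add: segment)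
    fix t :: real assume t: "0 < t" "t \<le> 1"
    have "\<psi> ((1 - t) *\<^sub>R z + t *\<^sub>R y) \<le> (1 - t) * \<psi> z + t * \<psi> y"
      using t z y by (intro convex_onD[OF convex_\<psi>]) auto
    then have "\<psi> (z + t *\<^sub>R (y - z)) \<le> (1 - t) * \<psi> z + t * \<psi> y" by (simp add: segment)
    with opt[OF in_C, of t] t
    have le: "a * \<omega> z \<le> t * (g \<bullet> (y - z)) + t * (\<psi> y - \<psi> z) + a * \<omega> (z + t *\<^sub>R (y - z))
        - a * t * (\<omega>' x \<bullet> (y - z))"
      by (simp add: bregman_def algebra_simps)
    have "a * (\<omega> z + t * r) = a * \<omega> z + t * (a * r)"
      by (simp add: algebra_simps)
    also have "\<dots> = a * \<omega> z + t * (a * (\<omega>' x \<bullet> (y - z)) - (g \<bullet> (y - z) + \<psi> y - \<psi> z))"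
      by (simp only: ar)
    also have "\<dots> \<le> a * \<omega> (z + t *\<^sub>R (y - z))"
      using le by (simp add: algebra_simps)
    finally show "\<omega> z + t * r \<le> \<omega> (z + t *\<^sub>R (y - z))"
      using a by simp
  qed
  then have "a * r \<le> a * (\<omega>' z \<bullet> (y - z))" using a by simp
  then show ?thesis unfolding ar by (simp add: algebra_simps)
qed

lemma mirror_step_inequality:
  assumes a: "0 < a" and step: "mirror_step a g x z" and y: "y \<in> C"
  shows "g \<bullet> (z - y) + \<psi> z - \<psi> y + \<mu> / 2 * (N (y - z))\<^sup>2 + a * D z y + a * D x z \<le> a * D x y"
proof -
  have z: "z \<in> C" using step unfolding mirror_step_def by simp
  have "\<psi> z + (- g - a *\<^sub>R (\<omega>' z - \<omega>' x)) \<bullet> (y - z) + \<mu> / 2 * (N (y - z))\<^sup>2 \<le> \<psi> y"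
    by (rule strong[OF z y mirror_step_optimality[OF a step]])
  moreover have "a * (D x y - D x z - D z y) = a * ((\<omega>' z - \<omega>' x) \<bullet> (y - z))"
    by (simp only: bregman_three_points)
  ultimately show ?thesis by (simp add: algebra_simps)
qed

text \<open>The step depends on the gradient and on the previous point only through \<open>g - a \<omega>'(x)\<close>, and does so
  continuously: adding the step inequalities of two steps, each tested at the other's result, leaves the
  strong monotonicity of \<open>\<omega>'\<close>. This is what makes the iterates measurable.\<close>

lemma mirror_step_lipschitz:
  assumes a: "0 < a" and step: "mirror_step a g x z" and step': "mirror_step a g' x' z'"
  shows "a * N (z - z') \<le> dual_norm N ((g - a *\<^sub>R \<omega>' x) - (g' - a *\<^sub>R \<omega>' x'))"
proof -
  let ?s = "(g - a *\<^sub>R \<omega>' x) - (g' - a *\<^sub>R \<omega>' x')"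
  have z: "z \<in> C" and z': "z' \<in> C" using step step' unfolding mirror_step_def by auto
  have strong_mono: "a * (N (z - z'))\<^sup>2 \<le> a * (D z z' + D z' z)"
    using bregman_lower_bound[OF dgf z z'] bregman_lower_bound[OF dgf z' z]
      is_norm_minus_commute[OF N_norm, of z z'] a by simp
  have drop: "0 \<le> \<mu> / 2 * (N u)\<^sup>2" for u using \<mu>_nonneg by simp
  have "a * (D z z' + D z' z) \<le> - (?s \<bullet> (z - z'))"
    using mirror_step_inequality[OF a step z'] mirror_step_inequality[OF a step' z]
      drop[of "z' - z"] drop[of "z - z'"]
    by (simp add: bregman_def algebra_simps)
  also have "\<dots> \<le> N (z - z') * dual_norm N ?s"
    using inner_le_dual_norm[OF N_norm, of "z' - z" ?s] is_norm_minus_commute[OF N_norm, of z z']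
    by (simp add: inner_diff_right inner_diff_left inner_commute algebra_simps)
  finally have "N (z - z') * (a * N (z - z')) \<le> N (z - z') * dual_norm N ?s"
    using strong_mono by (simp add: power2_eq_square algebra_simps)
  moreover have "0 \<le> N (z - z')" by (rule is_norm_nonneg[OF N_norm])
  ultimately show ?thesis
    using dual_norm_nonneg[OF N_norm, of ?s] by (cases "N (z - z') = 0") auto
qed

end

section \<open>The recursion with delays\<close>

lemma is_norm_telescope:
  assumes "is_norm N" "j \<le> k"
  shows "N (x (Suc k) - x j) \<le> (\<Sum>i=j..k. N (x (Suc i) - x i))"
proof -
  have "x (Suc k) - x j = (\<Sum>i=j..k. x (Suc i) - x i)"
    using assms(2) by (simp add: sum_Suc_diff)
  then show ?thesis using is_norm_sum[OF assms(1)] by metis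
qed

text \<open>With weights \<open>a k\<close> the strong convexity gain \<open>p\<close> dominates the growth of \<open>a\<close>, so that the sum
  telescopes. The negative terms absorb the delay terms because \<open>a\<close> grows by at most its own
  \<open>k\<close>-dependent part over a window of length \<open>\<tau>\<close>.\<close>

lemma delayed_weighted_recursion:
  fixes N :: "'a::real_vector \<Rightarrow> real" and V Z a :: "nat \<Rightarrow> real" and d :: "nat \<Rightarrow> nat"
  assumes N: "is_norm N" and L: "0 \<le> L" and p: "0 \<le> p"
    and a: "\<And>k. a k = 2 * L * (real \<tau> + 1)\<^sup>2 + p / 3 * (real k + real \<tau> + 1)"
    and d: "\<And>k. d k \<le> k" "\<And>k. k - d k \<le> \<tau>"
    and V: "\<And>k. 0 \<le> V k"
    and step: "\<And>k. (a k + p) * V (Suc k) \<le> a k * V k + L / 2 * (N (x (Suc k) - x (d k)))\<^sup>2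
      - a k / 4 * (N (x (Suc k) - x k))\<^sup>2 + Z k"
  shows "(a T)\<^sup>2 * V T \<le> (a 0)\<^sup>2 * V 0 + (\<Sum>k<T. a k * Z k)"
proof -
  define \<delta> where "\<delta> k = (N (x (Suc k) - x k))\<^sup>2" for k
  have \<delta>: "0 \<le> \<delta> k" for k by (simp add: \<delta>_def)
  have a_nonneg: "0 \<le> a k" for k unfolding a using L p by simp
  have weight: "(a (Suc k))\<^sup>2 \<le> a k * (a k + p)" for k
  proof -
    have "p / 3 * 1 \<le> p / 3 * (real k + real \<tau> + 1)"
      by (rule mult_left_mono) (use p in auto)
    then have "p / 3 \<le> a k" unfolding a using L by (simp add: add_increasing)
    then have "p * (p / 3) \<le> p * a k" using p by (rule mult_left_mono)
    moreover have "a (Suc k) = a k + p / 3" unfolding a by (simp add: algebra_simps)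
    ultimately show ?thesis by (simp add: power2_eq_square algebra_simps)
  qed
  have window: "a k * L / 2 * (N (x (Suc k) - x (d k)))\<^sup>2 \<le>
      (\<Sum>j=d k..k. (a j)\<^sup>2 / (4 * (real \<tau> + 1)) * \<delta> j)" for k
  proof -
    have "(N (x (Suc k) - x (d k)))\<^sup>2 \<le> (\<Sum>j=d k..k. N (x (Suc j) - x j))\<^sup>2"
      by (intro power_mono is_norm_telescope[OF N] is_norm_nonneg[OF N] d)
    also have "\<dots> \<le> (\<Sum>j=d k..k. \<delta> j) * card {d k..k}"
      unfolding \<delta>_def by (rule sum_squared_le_sum_of_squares)
    also have "\<dots> \<le> (\<Sum>j=d k..k. \<delta> j) * (real \<tau> + 1)"
      using d[of k] \<delta> by (intro mult_left_mono sum_nonneg) auto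
    finally have "a k * L / 2 * (N (x (Suc k) - x (d k)))\<^sup>2 \<le>
        a k * L / 2 * ((\<Sum>j=d k..k. \<delta> j) * (real \<tau> + 1))"
      using a_nonneg[of k] L by (intro mult_left_mono) auto
    also have "\<dots> = (\<Sum>j=d k..k. a k * L / 2 * (real \<tau> + 1) * \<delta> j)"
      by (simp add: sum_distrib_left sum_distrib_right algebra_simps)
    also have "\<dots> \<le> (\<Sum>j=d k..k. (a j)\<^sup>2 / (4 * (real \<tau> + 1)) * \<delta> j)"
    proof (intro sum_mono mult_right_mono \<delta>)
      fix j assume j: "j \<in> {d k..k}"
      \<comment> \<open>\<open>A\<close> is constant and \<open>B\<close> at most doubles over the window, so \<open>A (A + 2 B) \<le> (A + B)^2\<close> suffices.\<close>
      define A B where "A = 2 * L * (real \<tau> + 1)\<^sup>2" and "B = p / 3 * (real j + real \<tau> + 1)"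
      have AB: "0 \<le> A" "0 \<le> B" using L p by (auto simp: A_def B_def)
      have "k \<le> j + \<tau>" using j d[of k] by auto
      then have "real k \<le> real j + real \<tau>" by (simp flip: of_nat_add)
      then have "real k + real \<tau> + 1 \<le> 2 * (real j + real \<tau> + 1)"
        by (simp add: distrib_left)
      then have "p / 3 * (real k + real \<tau> + 1) \<le> p / 3 * (2 * (real j + real \<tau> + 1))"
        by (rule mult_left_mono) (use p in auto)
      then have "a k \<le> A + p / 3 * (2 * (real j + real \<tau> + 1))" unfolding a A_def by linarith
      then have "a k \<le> A + 2 * B" by (simp only: B_def mult.left_commute)
      then have "A * a k \<le> A * (A + 2 * B)" using AB by (intro mult_left_mono)
      also have "\<dots> \<le> (A + B)\<^sup>2" by (simp add: power2_eq_square algebra_simps)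
      also have "A + B = a j" by (simp add: a A_def B_def)
      finally show "a k * L / 2 * (real \<tau> + 1) \<le> (a j)\<^sup>2 / (4 * (real \<tau> + 1))"
        by (simp add: A_def field_simps power2_eq_square)
    qed
    finally show ?thesis .
  qed
  have absorb: "(\<Sum>k<T. a k * L / 2 * (N (x (Suc k) - x (d k)))\<^sup>2) \<le> (\<Sum>k<T. (a k)\<^sup>2 / 4 * \<delta> k)"
  proof -
    have "(\<Sum>k<T. a k * L / 2 * (N (x (Suc k) - x (d k)))\<^sup>2) \<le>
        (\<Sum>k<T. \<Sum>j=d k..k. (a j)\<^sup>2 / (4 * (real \<tau> + 1)) * \<delta> j)"
      by (intro sum_mono window)
    also have "\<dots> \<le> (\<Sum>k<T. \<Sum>j<T. if k \<in> {j..j + \<tau>} then (a j)\<^sup>2 / (4 * (real \<tau> + 1)) * \<delta> j else 0)"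
    proof (rule sum_mono)
      fix k assume k: "k \<in> {..<T}"
      have "(\<Sum>j=d k..k. (a j)\<^sup>2 / (4 * (real \<tau> + 1)) * \<delta> j) =
          (\<Sum>j=d k..k. if k \<in> {j..j + \<tau>} then (a j)\<^sup>2 / (4 * (real \<tau> + 1)) * \<delta> j else 0)"
        using d[of k] by (intro sum.cong) auto
      also have "\<dots> \<le> (\<Sum>j<T. if k \<in> {j..j + \<tau>} then (a j)\<^sup>2 / (4 * (real \<tau> + 1)) * \<delta> j else 0)"
        using k \<delta> by (intro sum_mono2) auto
      finally show "(\<Sum>j=d k..k. (a j)\<^sup>2 / (4 * (real \<tau> + 1)) * \<delta> j) \<le>
          (\<Sum>j<T. if k \<in> {j..j + \<tau>} then (a j)\<^sup>2 / (4 * (real \<tau> + 1)) * \<delta> j else 0)" .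
    qed
    also have "\<dots> = (\<Sum>j<T. \<Sum>k<T. if k \<in> {j..j + \<tau>} then (a j)\<^sup>2 / (4 * (real \<tau> + 1)) * \<delta> j else 0)"
      by (rule sum.swap)
    also have "\<dots> \<le> (\<Sum>j<T. (a j)\<^sup>2 / 4 * \<delta> j)"
    proof (rule sum_mono)
      fix j
      have "(\<Sum>k<T. if k \<in> {j..j + \<tau>} then (a j)\<^sup>2 / (4 * (real \<tau> + 1)) * \<delta> j else 0) =
          real (card ({..<T} \<inter> {j..j + \<tau>})) * ((a j)\<^sup>2 / (4 * (real \<tau> + 1)) * \<delta> j)"
        by (subst sum.inter_restrict[symmetric]) auto
      also have "\<dots> \<le> (real \<tau> + 1) * ((a j)\<^sup>2 / (4 * (real \<tau> + 1)) * \<delta> j)"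
      proof (rule mult_right_mono)
        have "card ({..<T} \<inter> {j..j + \<tau>}) \<le> card {j..j + \<tau>}" by (intro card_mono) auto
        then show "real (card ({..<T} \<inter> {j..j + \<tau>})) \<le> real \<tau> + 1" by simp
      qed (use \<delta> in auto)
      also have "\<dots> = (a j)\<^sup>2 / 4 * \<delta> j"
        by (simp add: field_simps add_eq_0_iff)
      finally show "(\<Sum>k<T. if k \<in> {j..j + \<tau>} then (a j)\<^sup>2 / (4 * (real \<tau> + 1)) * \<delta> j else 0)
          \<le> (a j)\<^sup>2 / 4 * \<delta> j" .
    qed
    finally show ?thesis .
  qed
  have "(a T)\<^sup>2 * V T \<le> (a 0)\<^sup>2 * V 0 + (\<Sum>k<T. a k * L / 2 * (N (x (Suc k) - x (d k)))\<^sup>2)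
      - (\<Sum>k<T. (a k)\<^sup>2 / 4 * \<delta> k) + (\<Sum>k<T. a k * Z k)"
  proof (induction T)
    case (Suc T)
    have "(a (Suc T))\<^sup>2 * V (Suc T) \<le> a T * (a T + p) * V (Suc T)"
      by (intro mult_right_mono weight V)
    also have "\<dots> \<le> a T * (a T * V T + L / 2 * (N (x (Suc T) - x (d T)))\<^sup>2
      - a T / 4 * (N (x (Suc T) - x T))\<^sup>2 + Z T)"
      using mult_left_mono[OF step a_nonneg] by (simp add: mult.assoc)
    finally show ?case using Suc by (simp add: \<delta>_def power2_eq_square algebra_simps)
  qed simp
  with absorb show ?thesis by linarith
qed

section \<open>Smooth dual potentials\<close>

text \<open>The properties of the convex conjugate \<open>W\<close> of \<open>\<omega>\<close>, with gradient \<open>G\<close>, that the noise estimate uses: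
  smoothness in the dual norm, the Fenchel inequality at points \<open>\<theta> x\<close> of the dual space that
  \<open>G\<close> maps back to \<open>x\<close>, and Lipschitz continuity of \<open>G\<close>. Stating them abstractly lets half the squared
  norm take the role of the conjugate when \<open>\<omega>\<close> is not defined everywhere.\<close>

definition dual_potential ::
    "('a::real_inner \<Rightarrow> real) \<Rightarrow> 'a set \<Rightarrow> ('a \<Rightarrow> real) \<Rightarrow> ('a \<Rightarrow> 'a) \<Rightarrow>
     ('a \<Rightarrow> real) \<Rightarrow> ('a \<Rightarrow> 'a) \<Rightarrow> ('a \<Rightarrow> 'a) \<Rightarrow> bool" where
  "dual_potential N C \<omega> \<omega>' W G \<theta> \<longleftrightarrow>
     (\<forall>s v. W (s + v) \<le> W s + v \<bullet> G s + 1 / 2 * (dual_norm N v)\<^sup>2) \<and>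
     (\<forall>x\<in>C. \<forall>z\<in>C. \<forall>v. v \<bullet> z - bregman \<omega> \<omega>' x z \<le> W (\<theta> x + v) - W (\<theta> x)) \<and>
     (\<exists>K. \<forall>s t. norm (G s - G t) \<le> K * norm (s - t)) \<and>
     continuous_on C \<theta> \<and> (\<forall>x\<in>C. G (\<theta> x) = x)"

text \<open>By strong convexity \<open>\<omega> z - s \<bullet> z\<close> grows quadratically, hence has a minimum, where \<open>\<omega>' z = s\<close>.\<close>

lemma surj_gradient_distance_generating:
  fixes N :: "'a::euclidean_space \<Rightarrow> real"
  assumes N: "is_norm N" and dgf: "distance_generating N UNIV \<omega> \<omega>'"
  shows "surj \<omega>'"
proof (rule surjI)
  fix s
  have deriv: "(\<omega> has_derivative (\<lambda>h. h \<bullet> \<omega>' x)) (at x)" for x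
    using dgf unfolding distance_generating_def by simp
  have strong: "\<omega> x + \<omega>' x \<bullet> (y - x) + 1 / 2 * (N (y - x))\<^sup>2 \<le> \<omega> y" for x y
    using dgf unfolding distance_generating_def by simp
  define h where "h = (\<lambda>z. \<omega> z - s \<bullet> z)"
  have hd: "(h has_derivative (\<lambda>v. v \<bullet> (\<omega>' x - s))) (at x)" for x
    unfolding h_def using deriv[of x]
    by (auto intro!: derivative_eq_intros simp: inner_diff_right inner_commute)
  then have cont: "continuous_on S h" for S
    by (meson continuous_at_imp_continuous_on has_derivative_continuous)
  obtain m K where m: "0 < m" "\<And>x. m * norm x \<le> N x"
    using is_norm_equivalent_norm[OF N] by metis
  define B where "B = norm (\<omega>' 0 - s)"
  \<comment> \<open>Beyond radius \<open>R\<close> the quadratic lower bound is at least \<open>h 0\<close>.\<close>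
  define R where "R = 2 * B / m\<^sup>2"
  have "0 \<le> R" by (simp add: R_def B_def)
  then have "cball (0::'a) R \<noteq> {}" by simp
  from continuous_attains_inf[OF compact_cball this cont]
  obtain z0 where "\<forall>z\<in>cball 0 R. h z0 \<le> h z" by blast
  then have z0: "h z0 \<le> h z" if "norm z \<le> R" for z using that by simp
  have "h z0 \<le> h z" for z
  proof (cases "norm z \<le> R")
    case False
    have "h 0 + (\<omega>' 0 - s) \<bullet> z + 1 / 2 * (N z)\<^sup>2 \<le> h z"
      using strong[of 0 z] by (simp add: h_def inner_diff_left)
    moreover have "- (B * norm z) \<le> (\<omega>' 0 - s) \<bullet> z"
      using norm_cauchy_schwarz[of "\<omega>' 0 - s" "- z"] by (simp add: B_def)
    moreover have "(m * norm z)\<^sup>2 \<le> (N z)\<^sup>2"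
      using m by (intro power_mono) auto
    moreover have "B * norm z \<le> 1 / 2 * (m * norm z)\<^sup>2"
    proof -
      have "2 * B \<le> m\<^sup>2 * norm z" using False m(1) by (simp add: R_def field_simps)
      then have "2 * B * norm z \<le> m\<^sup>2 * norm z * norm z" by (rule mult_right_mono) simp
      then show ?thesis by (simp add: power2_eq_square algebra_simps)
    qed
    moreover have "h z0 \<le> h 0" using \<open>0 \<le> R\<close> by (intro z0) simp
    ultimately show ?thesis by linarith
  qed (simp add: z0)
  \<comment> \<open>Testing minimality in the direction of steepest descent forces the gradient to vanish.\<close>
  then have "0 \<le> (\<omega>' z0 - s) \<bullet> ((z0 + (s - \<omega>' z0)) - z0)"
    using hd[of z0] by (intro directional_derivative_lower_bound[where h = h and S = UNIV]) auto
  then have "(\<omega>' z0 - s) \<bullet> (\<omega>' z0 - s) \<le> 0"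
    by (simp add: inner_diff_left inner_diff_right)
  then have "(\<omega>' z0 - s) \<bullet> (\<omega>' z0 - s) = 0"
    using inner_ge_zero[of "\<omega>' z0 - s"] by linarith
  then have "\<omega>' z0 = s" by simp
  then show "\<omega>' (SOME z. \<omega>' z = s) = s" by (rule someI)
qed

text \<open>The conjugate is written with its maximizer, \<open>W s = s \<bullet> G s - \<omega> (G s)\<close> for \<open>G\<close> the inverse of
  \<open>\<omega>'\<close>. Strong convexity of \<open>\<omega>\<close> at \<open>G s\<close> turns into smoothness of \<open>W\<close> at \<open>s\<close>.\<close>

lemma dual_potential_conjugate:
  fixes N :: "'a::euclidean_space \<Rightarrow> real"
  assumes N: "is_norm N" and dgf: "distance_generating N UNIV \<omega> \<omega>'"
  shows "\<exists>W G. dual_potential N C \<omega> \<omega>' W G \<omega>'"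
proof -
  define G where "G = inv \<omega>'"
  define W where "W = (\<lambda>s. s \<bullet> G s - \<omega> (G s))"
  have strong: "\<omega> x + \<omega>' x \<bullet> (y - x) + 1 / 2 * (N (y - x))\<^sup>2 \<le> \<omega> y" for x y
    using dgf unfolding distance_generating_def by simp
  have \<omega>'G: "\<omega>' (G s) = s" for s
    unfolding G_def by (rule surj_f_inv_f[OF surj_gradient_distance_generating[OF N dgf]])
  have mono: "(N (x - y))\<^sup>2 \<le> (\<omega>' x - \<omega>' y) \<bullet> (x - y)" for x y
    using strong[of x y] strong[of y x] is_norm_minus_commute[OF N, of x y]
    by (simp add: algebra_simps)
  have G\<omega>': "G (\<omega>' x) = x" for x
  proof -
    have "(N (G (\<omega>' x) - x))\<^sup>2 \<le> 0"
      using mono[of "G (\<omega>' x)" x] by (simp add: \<omega>'G)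
    then have "N (G (\<omega>' x) - x) = 0" by simp
    then show ?thesis using N unfolding is_norm_def by (metis eq_iff_diff_eq_0)
  qed
  have fenchel: "t \<bullet> z - \<omega> z \<le> W t" for t z
  proof -
    have "\<omega> (G t) + t \<bullet> (z - G t) \<le> \<omega> z"
      using strong[of "G t" z] zero_le_power2[of "N (z - G t)"] unfolding \<omega>'G by linarith
    then show ?thesis by (simp add: W_def inner_diff_right)
  qed
  have smooth: "W (s + v) \<le> W s + v \<bullet> G s + 1 / 2 * (dual_norm N v)\<^sup>2" for s v
    using strong[of "G s" "G (s + v)"] inner_le_half_squares[OF N, of v "G (s + v) - G s"]
    by (simp add: W_def \<omega>'G algebra_simps)
  have three: "v \<bullet> z - bregman \<omega> \<omega>' x z \<le> W (\<omega>' x + v) - W (\<omega>' x)" for x z v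
    using fenchel[of "\<omega>' x + v" z]
    by (simp add: W_def[of] bregman_def G\<omega>' algebra_simps)
  have lip: "\<exists>K. \<forall>s t. norm (G s - G t) \<le> K * norm (s - t)"
  proof -
    obtain m K where m: "0 < m" "\<And>x. m * norm x \<le> N x"
      using is_norm_equivalent_norm[OF N] by metis
    have "norm (G s - G t) \<le> 1 / m\<^sup>2 * norm (s - t)" for s t
    proof (cases "G s = G t")
      case False
      have "m\<^sup>2 * (norm (G s - G t))\<^sup>2 \<le> (N (G s - G t))\<^sup>2"
        using m by (metis mult_nonneg_nonneg norm_ge_zero order_less_imp_le power_mono power_mult_distrib)
      also have "\<dots> \<le> norm (s - t) * norm (G s - G t)"
        using mono[of "G s" "G t"] norm_cauchy_schwarz[of "s - t" "G s - G t"] by (simp add: \<omega>'G)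
      finally show ?thesis using False m(1) by (simp add: power2_eq_square field_simps)
    qed simp
    then show ?thesis by blast
  qed
  have "continuous_on UNIV \<omega>'" using dgf unfolding distance_generating_def by simp
  then have "continuous_on C \<omega>'" by (rule continuous_on_subset) simp
  with smooth three lip G\<omega>' have "dual_potential N C \<omega> \<omega>' W G \<omega>'"
    unfolding dual_potential_def by blast
  then show ?thesis by blast
qed

text \<open>Here \<open>\<omega>\<close> may be defined on \<open>C\<close> alone. Pairing a vector with itself bounds its Euclidean norm by \<open>N\<close>, so that
  \<open>D\<close> dominates half the squared Euclidean distance, whose conjugate is explicit.\<close>

lemma dual_potential_half_square:
  fixes N :: "'a::euclidean_space \<Rightarrow> real"
  assumes N: "is_norm N" and dual: "dual_norm N = norm" and dgf: "distance_generating N C \<omega> \<omega>'"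
  shows "dual_potential N C \<omega> \<omega>' (\<lambda>s. 1 / 2 * (norm s)\<^sup>2) (\<lambda>s. s) (\<lambda>x. x)"
proof -
  have norm_le: "norm x \<le> N x" for x
  proof (cases "x = 0")
    case False
    have "norm x * norm x \<le> N x * norm x"
      using inner_le_dual_norm[OF N, of x x] by (simp add: dual norm_eq_sqrt_inner)
    with False show ?thesis by simp
  qed (simp add: is_norm_zero[OF N])
  have *: "v \<bullet> z - bregman \<omega> \<omega>' x z \<le> 1 / 2 * (norm (x + v))\<^sup>2 - 1 / 2 * (norm x)\<^sup>2"
    if "x \<in> C" "z \<in> C" for x z v
  proof -
    have "(norm (z - x))\<^sup>2 \<le> (N (z - x))\<^sup>2" by (intro power_mono norm_le) simp
    then have "1 / 2 * (norm (z - x))\<^sup>2 \<le> bregman \<omega> \<omega>' x z"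
      using bregman_lower_bound[OF dgf that] by simp
    moreover have "0 \<le> (norm (v - (z - x)))\<^sup>2" by simp
    ultimately show ?thesis
      by (simp add: power2_norm_eq_inner algebra_simps inner_commute)
  qed
  have "1 / 2 * (norm (s + v))\<^sup>2 = 1 / 2 * (norm s)\<^sup>2 + v \<bullet> s + 1 / 2 * (norm v)\<^sup>2" for s v :: 'a
    by (simp add: power2_norm_eq_inner algebra_simps inner_commute)
  with * show ?thesis
    unfolding dual_potential_def dual by (auto intro!: exI[of _ 1])
qed

lemma dual_potential_sum_le:
  fixes n :: nat
  assumes "dual_potential N C \<omega> \<omega>' W G \<theta>"
  shows "W (s + (\<Sum>i=1..n. v i)) \<le> W s +
    (\<Sum>i=1..n. v i \<bullet> G (s + (\<Sum>l\<in>{1..<i}. v l)) + 1 / 2 * (dual_norm N (v i))\<^sup>2)"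
proof (induction n)
  case (Suc n)
  have "W (s + (\<Sum>i=1..n. v i) + v (Suc n)) \<le> W (s + (\<Sum>i=1..n. v i))
      + v (Suc n) \<bullet> G (s + (\<Sum>i=1..n. v i)) + 1 / 2 * (dual_norm N (v (Suc n)))\<^sup>2"
    using assms unfolding dual_potential_def by blast
  moreover have "{1..<Suc n} = {1..n}" by auto
  ultimately show ?case using Suc by (simp add: add.assoc)
qed simp

text \<open>The left-hand side is bounded, uniformly in \<open>z\<close>, by an increment of \<open>W\<close>, which is then expanded one
  sample error \<open>u i\<close> at a time. In the \<open>i\<close>-th summand the vector paired with \<open>u i\<close> involves only the
  errors before \<open>i\<close>.\<close>

lemma dual_potential_noise_bound:
  fixes N :: "'a::euclidean_space \<Rightarrow> real" and u :: "nat \<Rightarrow> 'a"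
  assumes N: "is_norm N" and pot: "dual_potential N C \<omega> \<omega>' W G \<theta>"
    and \<kappa>: "0 < \<kappa>" and b: "1 \<le> b" and x: "x \<in> C" and z: "z \<in> C"
  defines "e \<equiv> (1 / real b) *\<^sub>R (\<Sum>i=1..b. u i)"
  shows "- (e \<bullet> (z - y)) - \<kappa> * bregman \<omega> \<omega>' x z \<le>
    (\<Sum>i=1..b. 1 / real b * (u i \<bullet> (y - G (\<theta> x - (1 / (\<kappa> * real b)) *\<^sub>R (\<Sum>l\<in>{1..<i}. u l))))
       + (dual_norm N (u i))\<^sup>2 / (2 * \<kappa> * (real b)\<^sup>2))"
proof -
  define c where "c = 1 / (\<kappa> * real b)"
  have c: "0 \<le> c" "\<kappa> * c = 1 / real b" using \<kappa> b by (auto simp: c_def)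
  define v where "v = (\<lambda>i. - (c *\<^sub>R u i))"
  have sum_v: "(\<Sum>i\<in>I. v i) = - (c *\<^sub>R (\<Sum>i\<in>I. u i))" for I
    by (simp add: v_def sum_negf scaleR_sum_right)
  have e: "e = - (\<kappa> *\<^sub>R (\<Sum>i=1..b. v i))" using c by (simp add: e_def sum_v)
  have dual_v: "(dual_norm N (v i))\<^sup>2 = c\<^sup>2 * (dual_norm N (u i))\<^sup>2" for i
    using dual_norm_minus[OF N, of "c *\<^sub>R u i"] dual_norm_scaleR[OF N, of c "u i"]
    by (simp add: v_def power_mult_distrib)
  have "(\<Sum>i=1..b. v i) \<bullet> z - bregman \<omega> \<omega>' x z \<le> W (\<theta> x + (\<Sum>i=1..b. v i)) - W (\<theta> x)"
    using pot x z unfolding dual_potential_def by blast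
  also have "\<dots> \<le> (\<Sum>i=1..b. v i \<bullet> G (\<theta> x + (\<Sum>l\<in>{1..<i}. v l)) + 1 / 2 * (dual_norm N (v i))\<^sup>2)"
    using dual_potential_sum_le[OF pot, of "\<theta> x" v b] by simp
  finally have "\<kappa> * ((\<Sum>i=1..b. v i) \<bullet> z - bregman \<omega> \<omega>' x z) + e \<bullet> y \<le>
      \<kappa> * (\<Sum>i=1..b. v i \<bullet> G (\<theta> x + (\<Sum>l\<in>{1..<i}. v l)) + 1 / 2 * (dual_norm N (v i))\<^sup>2) + e \<bullet> y"
    using \<kappa> by simp
  also have "\<dots> = (\<Sum>i=1..b. (\<kappa> * c) * (u i \<bullet> (y - G (\<theta> x + (\<Sum>l\<in>{1..<i}. v l))))
       + \<kappa> * c\<^sup>2 / 2 * (dual_norm N (u i))\<^sup>2)"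
    unfolding dual_v e
    by (simp add: v_def sum_distrib_left inner_sum_left sum.distrib sum_negf inner_diff_right
        sum_subtractf right_diff_distrib distrib_left algebra_simps)
  also have "\<kappa> * c\<^sup>2 / 2 = 1 / (2 * \<kappa> * (real b)\<^sup>2)"
    using \<kappa> b by (simp add: c_def power2_eq_square field_simps)
  also have "\<kappa> * ((\<Sum>i=1..b. v i) \<bullet> z - bregman \<omega> \<omega>' x z) + e \<bullet> y =
      - (e \<bullet> (z - y)) - \<kappa> * bregman \<omega> \<omega>' x z"
    by (simp add: e inner_diff_right right_diff_distrib)
  finally show ?thesis
    unfolding c(2) sum_v by (simp flip: c_def)
qed

lemma exists_dual_potential:
  fixes N :: "'a::euclidean_space \<Rightarrow> real"
  assumes N: "is_norm N" and dgf: "distance_generating N X \<omega> \<omega>'" and sub: "C \<subseteq> X"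
    and UNIV: "dual_norm N \<noteq> norm \<Longrightarrow> X = UNIV"
  shows "\<exists>W G \<theta>. dual_potential N C \<omega> \<omega>' W G \<theta>"
proof (cases "dual_norm N = norm")
  case True
  with dual_potential_half_square[OF N True distance_generating_subset[OF dgf sub]]
  show ?thesis by blast
next
  case False
  with dual_potential_conjugate[OF N, of \<omega> \<omega>' C] dgf UNIV show ?thesis by blast
qed

section \<open>Fresh samples and the past\<close>

text \<open>The argument \<open>y\<close> is approximated by simple functions of \<open>y\<close>, each of which takes finitely many
  values, so that only finitely many sections of \<open>h\<close> occur at a time.\<close>

lemma borel_measurable_Caratheodory:
  fixes h :: "'a::euclidean_space \<Rightarrow> 's \<Rightarrow> 'b::euclidean_space"
  assumes meas: "\<And>y. h y \<in> borel_measurable P"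
    and cont: "\<And>s. s \<in> space P \<Longrightarrow> continuous_on UNIV (\<lambda>y. h y s)"
  shows "(\<lambda>(y, s). h y s) \<in> borel_measurable (borel \<Otimes>\<^sub>M P)"
proof -
  obtain q where "\<forall>n. simple_function borel (q n)"
      "\<forall>y\<in>space borel. (\<lambda>n. q n y) \<longlonglongrightarrow> (y::'a)"
    using borel_measurable_implies_sequence_metric[of "\<lambda>y::'a. y" borel 0] by fastforce
  then have q: "\<And>n. simple_function borel (q n)" "\<And>y. (\<lambda>n. q n y) \<longlonglongrightarrow> y"
    by simp_all
  have "(\<lambda>ys. h (fst ys) (snd ys)) \<in> borel_measurable (borel \<Otimes>\<^sub>M P)"
  proof (rule borel_measurable_LIMSEQ_metric)
    fix n
    let ?R = "q n ` UNIV"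
    have fin: "finite ?R" using simple_functionD(1)[OF q(1)[of n]] by simp
    show "(\<lambda>ys. h (q n (fst ys)) (snd ys)) \<in> borel_measurable (borel \<Otimes>\<^sub>M P)"
    proof (rule measurable_compose_countable'[where I = ?R])
      show "(\<lambda>ys. h r (snd ys)) \<in> borel_measurable (borel \<Otimes>\<^sub>M P)" for r
        using meas[of r] by simp
      have "q n \<in> measurable borel (count_space ?R)"
        using simple_functionD(2)[OF q(1)[of n]] fin
        by (auto simp: measurable_count_space_eq2)
      then show "(\<lambda>ys. q n (fst ys)) \<in> measurable (borel \<Otimes>\<^sub>M P) (count_space ?R)"
        by (rule measurable_compose[OF measurable_fst])
      show "countable ?R" using fin by (rule countable_finite)
    qed
  next
    fix ys :: "'a \<times> 's" assume "ys \<in> space (borel \<Otimes>\<^sub>M P)"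
    then have "isCont (\<lambda>y. h y (snd ys)) (fst ys)"
      using cont[of "snd ys"] by (auto simp: space_pair_measure continuous_on_eq_continuous_at)
    then show "(\<lambda>n. h (q n (fst ys)) (snd ys)) \<longlonglongrightarrow> h (fst ys) (snd ys)"
      by (rule isCont_tendsto_compose[where g = "\<lambda>y. h y (snd ys)"]) (rule q(2))
  qed
  then show ?thesis by (simp add: case_prod_beta')
qed

locale sample_family = prob_space M for M :: "'w measure" +
  fixes P :: "'s measure" and \<xi> :: "'i \<Rightarrow> 'w \<Rightarrow> 's" and I :: "'i set"
  assumes prob_P: "prob_space P"
    and indep: "indep_vars (\<lambda>_. P) \<xi> I"
    and distr_\<xi>: "\<And>i. i \<in> I \<Longrightarrow> distr M P (\<xi> i) = P"
begin

text \<open>Being determined by the samples in \<open>J\<close> is expressed as measurability with respect to this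
  \<open>\<sigma>\<close>-algebra, so that the iterates need not be written as explicit functions of the samples.\<close>

definition history :: "'i set \<Rightarrow> 'w measure" where
  "history J = vimage_algebra (space M) (\<lambda>w. \<lambda>i\<in>J. \<xi> i w) (Pi\<^sub>M J (\<lambda>_. P))"

lemma space_history [simp]: "space (history J) = space M"
  by (simp add: history_def)

lemma \<xi>_measurable: "i \<in> I \<Longrightarrow> \<xi> i \<in> measurable M P"
  using indep unfolding indep_vars_def by simp

lemma restriction_in_space:
  assumes "J \<subseteq> I"
  shows "(\<lambda>w. \<lambda>i\<in>J. \<xi> i w) \<in> space M \<rightarrow> space (Pi\<^sub>M J (\<lambda>_. P))"
proof
  fix w assume w: "w \<in> space M"
  have "\<xi> i w \<in> space P" if "i \<in> J" for i
    using measurable_space[OF \<xi>_measurable w] assms that by blast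
  then show "(\<lambda>i\<in>J. \<xi> i w) \<in> space (Pi\<^sub>M J (\<lambda>_. P))" by (simp add: space_PiM)
qed

lemma \<xi>_measurable_history:
  assumes "J \<subseteq> I" "i \<in> J"
  shows "\<xi> i \<in> measurable (history J) P"
proof -
  have "(\<lambda>w. \<lambda>i\<in>J. \<xi> i w) \<in> measurable (history J) (Pi\<^sub>M J (\<lambda>_. P))"
    unfolding history_def by (rule measurable_vimage_algebra1[OF restriction_in_space[OF assms(1)]])
  from measurable_compose[OF this measurable_component_singleton[OF assms(2)]]
  show ?thesis using assms(2) by simp
qed

lemma measurable_history_transfer:
  assumes Y: "Y \<in> measurable (history J) S" and space: "space M' = space M"
    and \<xi>: "\<And>i. i \<in> J \<Longrightarrow> \<xi> i \<in> measurable M' P"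
  shows "Y \<in> measurable M' S"
proof -
  have "(\<lambda>w. \<lambda>i\<in>J. \<xi> i w) \<in> measurable M' (Pi\<^sub>M J (\<lambda>_. P))"
    using \<xi> by (rule measurable_restrict)
  then have "(\<lambda>w. w) \<in> measurable M' (history J)"
    unfolding history_def by (intro measurable_vimage_algebra2) (auto simp: space)
  from measurable_compose[OF this Y] show ?thesis .
qed

lemma measurable_history_mono:
  "Y \<in> measurable (history J) S \<Longrightarrow> J \<subseteq> J' \<Longrightarrow> J' \<subseteq> I \<Longrightarrow> Y \<in> measurable (history J') S"
  by (rule measurable_history_transfer) (auto intro: \<xi>_measurable_history)

lemma measurable_from_history:
  "Y \<in> measurable (history J) S \<Longrightarrow> J \<subseteq> I \<Longrightarrow> Y \<in> measurable M S"
  by (rule measurable_history_transfer) (auto intro: \<xi>_measurable)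

lemma prob_fresh_sample:
  assumes Y: "Y \<in> measurable (history J) S" and J: "J \<subseteq> I" and i: "i \<in> I" "i \<notin> J"
    and A: "A \<in> sets S" and B: "B \<in> sets P"
  shows "prob ((Y -` A \<inter> space M) \<inter> (\<xi> i -` B \<inter> space M)) =
    prob (Y -` A \<inter> space M) * prob (\<xi> i -` B \<inter> space M)"
proof -
  let ?U = "\<lambda>w. \<lambda>i\<in>J. \<xi> i w" and ?V = "\<lambda>w. \<lambda>j\<in>{i}. \<xi> j w"
  have "indep_var (Pi\<^sub>M J (\<lambda>_. P)) ?U (Pi\<^sub>M {i} (\<lambda>_. P)) ?V"
    using J i by (intro indep_var_restrict[OF indep]) auto
  then have "indep_set
      (sigma_sets (space M) {?U -` A \<inter> space M | A. A \<in> sets (Pi\<^sub>M J (\<lambda>_. P))})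
      (sigma_sets (space M) {?V -` A \<inter> space M | A. A \<in> sets (Pi\<^sub>M {i} (\<lambda>_. P))})"
    unfolding indep_var_eq by simp
  moreover have "Y -` A \<inter> space M \<in>
      sigma_sets (space M) {?U -` A \<inter> space M | A. A \<in> sets (Pi\<^sub>M J (\<lambda>_. P))}"
    using measurable_sets[OF Y A] by (simp add: history_def sets_vimage_algebra)
  moreover have "\<xi> i -` B \<inter> space M \<in>
      sigma_sets (space M) {?V -` A \<inter> space M | A. A \<in> sets (Pi\<^sub>M {i} (\<lambda>_. P))}"
  proof -
    let ?B = "(\<lambda>f. f i) -` B \<inter> space (Pi\<^sub>M {i} (\<lambda>_. P))"
    have "(\<lambda>f. f i) \<in> measurable (Pi\<^sub>M {i} (\<lambda>_. P)) P"
      by (rule measurable_component_singleton) simp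
    from measurable_sets[OF this B] have "?B \<in> sets (Pi\<^sub>M {i} (\<lambda>_. P))" .
    moreover have "\<xi> i -` B \<inter> space M = ?V -` ?B \<inter> space M"
      using measurable_space[OF \<xi>_measurable[OF i(1)]] by (auto simp: space_PiM)
    ultimately show ?thesis by (intro sigma_sets.Basic) blast
  qed
  ultimately show ?thesis unfolding indep_sets2_eq by meson
qed

text \<open>A sample outside \<open>J\<close> may be integrated out separately, by Fubini, with everything determined by the
  samples in \<open>J\<close> held fixed.\<close>

lemma distr_fresh_sample:
  assumes Y: "Y \<in> measurable (history J) S" and J: "J \<subseteq> I" and i: "i \<in> I" "i \<notin> J"
  shows "distr M (S \<Otimes>\<^sub>M P) (\<lambda>w. (Y w, \<xi> i w)) = distr M S Y \<Otimes>\<^sub>M P"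
proof (rule pair_measure_eqI[symmetric])
  have Y': "Y \<in> measurable M S" by (rule measurable_from_history[OF Y J])
  note \<xi>' = \<xi>_measurable[OF i(1)]
  interpret P: prob_space P by (rule prob_P)
  interpret D: prob_space "distr M S Y" using Y' by (rule prob_space_distr)
  show "sigma_finite_measure P" "sigma_finite_measure (distr M S Y)" by unfold_locales
  show "sets (distr M S Y \<Otimes>\<^sub>M P) = sets (distr M (S \<Otimes>\<^sub>M P) (\<lambda>w. (Y w, \<xi> i w)))"
    by (simp cong: sets_pair_measure_cong)
  fix A B assume A: "A \<in> sets (distr M S Y)" and B: "B \<in> sets P"
  have "emeasure (distr M S Y) A * emeasure (distr M P (\<xi> i)) B =
      ennreal (prob (Y -` A \<inter> space M) * prob (\<xi> i -` B \<inter> space M))"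
    using A B Y' \<xi>' by (simp add: emeasure_distr emeasure_eq_measure ennreal_mult)
  also have "\<dots> = emeasure M ((Y -` A \<inter> space M) \<inter> (\<xi> i -` B \<inter> space M))"
    using A prob_fresh_sample[OF Y J i _ B] by (simp add: emeasure_eq_measure)
  also have "(Y -` A \<inter> space M) \<inter> (\<xi> i -` B \<inter> space M) = (\<lambda>w. (Y w, \<xi> i w)) -` (A \<times> B) \<inter> space M"
    by auto
  also have "emeasure M \<dots> = emeasure (distr M (S \<Otimes>\<^sub>M P) (\<lambda>w. (Y w, \<xi> i w))) (A \<times> B)"
    using A B Y' \<xi>' by (subst emeasure_distr) auto
  finally show "emeasure (distr M S Y) A * emeasure P B =
      emeasure (distr M (S \<Otimes>\<^sub>M P) (\<lambda>w. (Y w, \<xi> i w))) (A \<times> B)"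
    by (simp add: distr_\<xi>[OF i(1)])
qed

lemma nn_integral_fresh_sample:
  assumes Y: "Y \<in> measurable (history J) S" and J: "J \<subseteq> I" and i: "i \<in> I" "i \<notin> J"
    and h: "(\<lambda>(y, s). h y s) \<in> borel_measurable (S \<Otimes>\<^sub>M P)"
  shows "(\<integral>\<^sup>+w. h (Y w) (\<xi> i w) \<partial>M) = (\<integral>\<^sup>+w. (\<integral>\<^sup>+s. h (Y w) s \<partial>P) \<partial>M)"
proof -
  interpret P: prob_space P by (rule prob_P)
  have Y': "Y \<in> measurable M S" by (rule measurable_from_history[OF Y J])
  have inner: "(\<lambda>y. \<integral>\<^sup>+s. h y s \<partial>P) \<in> borel_measurable S"
    using P.borel_measurable_nn_integral[OF h] by simp
  have "(\<integral>\<^sup>+w. h (Y w) (\<xi> i w) \<partial>M) =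
      (\<integral>\<^sup>+ys. (case ys of (y, s) \<Rightarrow> h y s) \<partial>distr M (S \<Otimes>\<^sub>M P) (\<lambda>w. (Y w, \<xi> i w)))"
    using h Y' \<xi>_measurable[OF i(1)] by (subst nn_integral_distr) auto
  also have "\<dots> = (\<integral>\<^sup>+y. (\<integral>\<^sup>+s. h y s \<partial>P) \<partial>distr M S Y)"
    unfolding distr_fresh_sample[OF Y J i]
    using P.nn_integral_fst[of "\<lambda>(y, s). h y s" "distr M S Y"] h by simp
  also have "\<dots> = (\<integral>\<^sup>+w. (\<integral>\<^sup>+s. h (Y w) s \<partial>P) \<partial>M)"
    using Y' inner by (subst nn_integral_distr) auto
  finally show ?thesis .
qed

lemma integral_fresh_sample:
  fixes h :: "'y \<Rightarrow> 's \<Rightarrow> real"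
  assumes Y: "Y \<in> measurable (history J) S" and J: "J \<subseteq> I" and i: "i \<in> I" "i \<notin> J"
    and h: "(\<lambda>(y, s). h y s) \<in> borel_measurable (S \<Otimes>\<^sub>M P)"
    and int: "integrable M (\<lambda>w. h (Y w) (\<xi> i w))"
  shows "(\<integral>w. h (Y w) (\<xi> i w) \<partial>M) = (\<integral>w. (\<integral>s. h (Y w) s \<partial>P) \<partial>M)"
proof -
  interpret P: prob_space P by (rule prob_P)
  have Y': "Y \<in> measurable M S" by (rule measurable_from_history[OF Y J])
  have inner: "(\<lambda>y. \<integral>s. h y s \<partial>P) \<in> borel_measurable S"
    using P.borel_measurable_lebesgue_integral[OF h] by simp
  interpret D: prob_space "distr M S Y" using Y' by (rule prob_space_distr)
  interpret pair_sigma_finite "distr M S Y" P ..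
  have pair: "(\<lambda>w. (Y w, \<xi> i w)) \<in> measurable M (S \<Otimes>\<^sub>M P)"
    using Y' \<xi>_measurable[OF i(1)] by simp
  have "integrable (distr M (S \<Otimes>\<^sub>M P) (\<lambda>w. (Y w, \<xi> i w))) (\<lambda>(y, s). h y s)"
    using int integrable_distr_eq[OF pair h] by simp
  then have int': "integrable (distr M S Y \<Otimes>\<^sub>M P) (\<lambda>(y, s). h y s)"
    unfolding distr_fresh_sample[OF Y J i] .
  have "(\<integral>w. h (Y w) (\<xi> i w) \<partial>M) =
      (\<integral>ys. (case ys of (y, s) \<Rightarrow> h y s) \<partial>distr M (S \<Otimes>\<^sub>M P) (\<lambda>w. (Y w, \<xi> i w)))"
    using integral_distr[OF pair h] by simp
  also have "\<dots> = (\<integral>y. (\<integral>s. h y s \<partial>P) \<partial>distr M S Y)"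
    unfolding distr_fresh_sample[OF Y J i] using integral_fst'[OF int'] by simp
  also have "\<dots> = (\<integral>w. (\<integral>s. h (Y w) s \<partial>P) \<partial>M)"
    using integral_distr[OF Y' inner] by simp
  finally show ?thesis .
qed

end

section \<open>Stochastic gradients\<close>

lemma square_integrable_add:
  fixes g h :: "'w \<Rightarrow> 'a::euclidean_space"
  assumes [measurable]: "g \<in> borel_measurable M" "h \<in> borel_measurable M"
    and int: "integrable M (\<lambda>w. (norm (g w))\<^sup>2)" "integrable M (\<lambda>w. (norm (h w))\<^sup>2)"
  shows "integrable M (\<lambda>w. (norm (g w + h w))\<^sup>2)"
proof (rule Bochner_Integration.integrable_bound)
  show "integrable M (\<lambda>w. 2 * (norm (g w))\<^sup>2 + 2 * (norm (h w))\<^sup>2)" using int by simp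
  have "(norm (g w + h w))\<^sup>2 \<le> 2 * (norm (g w))\<^sup>2 + 2 * (norm (h w))\<^sup>2" for w
  proof -
    have "(norm (g w + h w))\<^sup>2 \<le> (norm (g w) + norm (h w))\<^sup>2"
      by (intro power_mono norm_triangle_ineq) simp
    also have "\<dots> \<le> 2 * (norm (g w))\<^sup>2 + 2 * (norm (h w))\<^sup>2"
      using zero_le_power2[of "norm (g w) - norm (h w)"]
      by (simp add: power2_eq_square algebra_simps)
    finally show ?thesis .
  qed
  then show "AE w in M. norm ((norm (g w + h w))\<^sup>2) \<le>
      norm (2 * (norm (g w))\<^sup>2 + 2 * (norm (h w))\<^sup>2)"
    by (auto intro!: AE_I2 simp: abs_of_nonneg)
qed measurable

lemma square_integrable_sum:
  fixes g :: "'i \<Rightarrow> 'w \<Rightarrow> 'a::euclidean_space"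
  assumes "finite J" "\<And>i. i \<in> J \<Longrightarrow> g i \<in> borel_measurable M"
    and "\<And>i. i \<in> J \<Longrightarrow> integrable M (\<lambda>w. (norm (g i w))\<^sup>2)"
  shows "integrable M (\<lambda>w. (norm (\<Sum>i\<in>J. g i w))\<^sup>2)"
  using assms
proof (induction J)
  case (insert i J)
  have "integrable M (\<lambda>w. (norm (g i w + (\<Sum>i\<in>J. g i w)))\<^sup>2)"
    using insert by (intro square_integrable_add borel_measurable_sum) auto
  with insert(1,2) show ?case by simp
qed simp

lemma square_integrable_norm_le:
  fixes g :: "'w \<Rightarrow> 'a::euclidean_space" and h :: "'w \<Rightarrow> 'b::euclidean_space"
  assumes [measurable]: "g \<in> borel_measurable M"
    and int: "integrable M (\<lambda>w. (norm (h w))\<^sup>2)"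
    and le: "\<And>w. w \<in> space M \<Longrightarrow> norm (g w) \<le> K * norm (h w)"
  shows "integrable M (\<lambda>w. (norm (g w))\<^sup>2)"
proof (rule Bochner_Integration.integrable_bound)
  show "integrable M (\<lambda>w. K\<^sup>2 * (norm (h w))\<^sup>2)" using int by simp
  have "(norm (g w))\<^sup>2 \<le> K\<^sup>2 * (norm (h w))\<^sup>2" if "w \<in> space M" for w
    using power_mono[OF le[OF that], of 2] by (simp add: power_mult_distrib)
  then show "AE w in M. norm ((norm (g w))\<^sup>2) \<le> norm (K\<^sup>2 * (norm (h w))\<^sup>2)"
    by (auto intro!: AE_I2)
qed measurable

locale gradient_oracle = sample_family M P \<xi> I
  for M :: "'w measure" and P :: "'s measure" and \<xi> :: "'i \<Rightarrow> 'w \<Rightarrow> 's" and I +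
  fixes N :: "'a::euclidean_space \<Rightarrow> real" and F' :: "'a \<Rightarrow> 's \<Rightarrow> 'a" and f' :: "'a \<Rightarrow> 'a"
    and L \<sigma> :: real
  assumes oracle_norm: "is_norm N"
    and F'_integrable: "\<And>y. integrable P (F' y)"
    and f'_eq: "\<And>y. f' y = (\<integral>s. F' y s \<partial>P)"
    and F'_smooth: "\<And>s y z. s \<in> space P \<Longrightarrow> dual_norm N (F' y s - F' z s) \<le> L * N (y - z)"
    and variance: "\<And>y. (\<integral>\<^sup>+s. ennreal ((dual_norm N (F' y s - f' y))\<^sup>2) \<partial>P) \<le> ennreal (\<sigma>\<^sup>2)"
begin

lemma F'_measurable [measurable]: "(\<lambda>(y, s). F' y s) \<in> borel_measurable (borel \<Otimes>\<^sub>M P)"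
proof (rule borel_measurable_Caratheodory)
  show "F' y \<in> borel_measurable P" for y using F'_integrable[of y] by simp
  fix s assume s: "s \<in> space P"
  obtain K where K: "0 < K" "\<And>y. norm y \<le> K * dual_norm N y"
    using norm_le_dual_norm[OF oracle_norm] by metis
  obtain m K' where K': "\<And>x. N x \<le> K' * norm x" "0 < K'"
    using is_norm_equivalent_norm[OF oracle_norm] by metis
  have "norm (F' y s - F' z s) \<le> (K * \<bar>L\<bar> * K') * norm (y - z)" for y z
  proof -
    have "norm (F' y s - F' z s) \<le> K * (L * N (y - z))"
      using K(2)[of "F' y s - F' z s"] mult_left_mono[OF F'_smooth[OF s, of y z], of K] K(1)
      by linarith
    also have "\<dots> \<le> K * (\<bar>L\<bar> * (K' * norm (y - z)))"
      using K(1) K' is_norm_nonneg[OF oracle_norm] by (intro mult_left_mono mult_mono) auto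
    finally show ?thesis by (simp add: algebra_simps)
  qed
  then have "(K * \<bar>L\<bar> * K')-lipschitz_on UNIV (\<lambda>y. F' y s)"
    using K K' by (intro lipschitz_onI) (auto simp: dist_norm)
  then show "continuous_on UNIV (\<lambda>y. F' y s)" by (rule lipschitz_on_continuous_on)
qed

lemma f'_measurable [measurable]: "f' \<in> borel_measurable borel"
proof -
  interpret P: prob_space P by (rule prob_P)
  have "(\<lambda>y. \<integral>s. F' y s \<partial>P) \<in> borel_measurable borel" by measurable
  then show ?thesis by (simp add: f'_eq[abs_def])
qed

lemma dual_norm_measurable [measurable]: "dual_norm N \<in> borel_measurable borel"
  by (intro borel_measurable_continuous_onI continuous_on_dual_norm oracle_norm)

lemma norm_measurable [measurable]: "N \<in> borel_measurable borel"
  by (intro borel_measurable_continuous_onI continuous_on_is_norm oracle_norm)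

definition error :: "('w \<Rightarrow> 'a) \<Rightarrow> 'i \<Rightarrow> 'w \<Rightarrow> 'a" where
  "error A i w = F' (A w) (\<xi> i w) - f' (A w)"

lemma error_measurable:
  assumes "A \<in> borel_measurable M'" "\<xi> i \<in> measurable M' P"
  shows "error A i \<in> borel_measurable M'"
proof -
  note [measurable] = assms
  show ?thesis unfolding error_def by measurable
qed

lemma integrable_error_dual_norm:
  assumes A: "A \<in> borel_measurable (history J)" and J: "J \<subseteq> I" and i: "i \<in> I" "i \<notin> J"
  shows "integrable M (\<lambda>w. (dual_norm N (error A i w))\<^sup>2)"
    and "(\<integral>w. (dual_norm N (error A i w))\<^sup>2 \<partial>M) \<le> \<sigma>\<^sup>2"
proof -
  have [measurable]: "error A i \<in> borel_measurable M"
    using measurable_from_history[OF A J] \<xi>_measurable[OF i(1)] by (rule error_measurable)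
  have "(\<integral>\<^sup>+w. ennreal ((dual_norm N (error A i w))\<^sup>2) \<partial>M) =
      (\<integral>\<^sup>+w. (\<integral>\<^sup>+s. ennreal ((dual_norm N (F' (A w) s - f' (A w)))\<^sup>2) \<partial>P) \<partial>M)"
    unfolding error_def
    by (rule nn_integral_fresh_sample[OF A J i]) measurable
  also have "\<dots> \<le> (\<integral>\<^sup>+w. ennreal (\<sigma>\<^sup>2) \<partial>M)" by (intro nn_integral_mono variance)
  finally have le: "(\<integral>\<^sup>+w. ennreal ((dual_norm N (error A i w))\<^sup>2) \<partial>M) \<le> ennreal (\<sigma>\<^sup>2)"
    by (simp add: emeasure_space_1)
  show int: "integrable M (\<lambda>w. (dual_norm N (error A i w))\<^sup>2)"
    using le by (intro integrableI_bounded) (auto simp: order.strict_trans1)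
  have "ennreal (\<integral>w. (dual_norm N (error A i w))\<^sup>2 \<partial>M) \<le> ennreal (\<sigma>\<^sup>2)"
    using le nn_integral_eq_integral[OF int] by simp
  then show "(\<integral>w. (dual_norm N (error A i w))\<^sup>2 \<partial>M) \<le> \<sigma>\<^sup>2" by simp
qed

lemma square_integrable_error:
  assumes A: "A \<in> borel_measurable (history J)" and J: "J \<subseteq> I" and i: "i \<in> I" "i \<notin> J"
  shows "integrable M (\<lambda>w. (norm (error A i w))\<^sup>2)"
proof -
  obtain K where K: "0 < K" "\<And>y. norm y \<le> K * dual_norm N y"
    using norm_le_dual_norm[OF oracle_norm] by metis
  have meas: "error A i \<in> borel_measurable M"
    using measurable_from_history[OF A J] \<xi>_measurable[OF i(1)] by (rule error_measurable)
  show ?thesis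
  proof (rule square_integrable_norm_le[OF meas])
    show "integrable M (\<lambda>w. (norm (dual_norm N (error A i w)))\<^sup>2)"
      using integrable_error_dual_norm(1)[OF assms] by simp
    show "norm (error A i w) \<le> K * norm (dual_norm N (error A i w))" for w
      using K(2) dual_norm_nonneg[OF oracle_norm] by simp
  qed
qed

text \<open>Conditionally on the past, the fresh sample gives an unbiased gradient at \<open>A\<close>, so its error has
  mean zero against any vector the past determines.\<close>

lemma error_orthogonal_past:
  assumes A: "A \<in> borel_measurable (history J)" and J: "J \<subseteq> I" and i: "i \<in> I" "i \<notin> J"
    and B: "B \<in> borel_measurable (history J)" "integrable M (\<lambda>w. (norm (B w))\<^sup>2)"
  shows "integrable M (\<lambda>w. error A i w \<bullet> B w)"
    and "(\<integral>w. error A i w \<bullet> B w \<partial>M) = 0"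
proof -
  interpret P: prob_space P by (rule prob_P)
  have [measurable]: "error A i \<in> borel_measurable M"
    using measurable_from_history[OF A J] \<xi>_measurable[OF i(1)] by (rule error_measurable)
  have [measurable]: "B \<in> borel_measurable M" using B(1) J by (rule measurable_from_history)
  show int: "integrable M (\<lambda>w. error A i w \<bullet> B w)"
  proof (rule Bochner_Integration.integrable_bound)
    show "integrable M (\<lambda>w. (norm (error A i w))\<^sup>2 + (norm (B w))\<^sup>2)"
      using square_integrable_error[OF A J i] B(2) by simp
    have "\<bar>error A i w \<bullet> B w\<bar> \<le> (norm (error A i w))\<^sup>2 + (norm (B w))\<^sup>2" for w
    proof -
      have "\<bar>error A i w \<bullet> B w\<bar> \<le> norm (error A i w) * norm (B w)"
        by (rule Cauchy_Schwarz_ineq2)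
      moreover have "2 * (norm (error A i w) * norm (B w)) \<le> (norm (error A i w))\<^sup>2 + (norm (B w))\<^sup>2"
        using zero_le_power2[of "norm (error A i w) - norm (B w)"]
        by (simp add: power2_eq_square algebra_simps)
      moreover have "0 \<le> norm (error A i w) * norm (B w)" by simp
      ultimately show ?thesis by linarith
    qed
    then show "AE w in M. norm (error A i w \<bullet> B w) \<le>
        norm ((norm (error A i w))\<^sup>2 + (norm (B w))\<^sup>2)"
      by (auto intro!: AE_I2)
  qed measurable
  let ?h = "\<lambda>(a, c) s. (F' a s - f' a) \<bullet> c"
  have "(\<lambda>w. (A w, B w)) \<in> measurable (history J) (borel \<Otimes>\<^sub>M borel)" using A B(1) by simp
  moreover have "(\<lambda>(y, s). ?h y s) \<in> borel_measurable ((borel \<Otimes>\<^sub>M borel) \<Otimes>\<^sub>M P)"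
    by (simp add: case_prod_beta') measurable
  moreover have "integrable M (\<lambda>w. ?h (A w, B w) (\<xi> i w))"
    using int by (simp add: error_def)
  ultimately have "(\<integral>w. ?h (A w, B w) (\<xi> i w) \<partial>M) = (\<integral>w. (\<integral>s. ?h (A w, B w) s \<partial>P) \<partial>M)"
    by (intro integral_fresh_sample[OF _ J i])
  also have "\<dots> = (\<integral>w. 0 \<partial>M)"
  proof (rule Bochner_Integration.integral_cong[OF refl])
    fix w
    have "(\<integral>s. (F' (A w) s - f' (A w)) \<bullet> B w \<partial>P) = (\<integral>s. F' (A w) s - f' (A w) \<partial>P) \<bullet> B w"
      using F'_integrable by (intro integral_inner_left) auto
    also have "(\<integral>s. F' (A w) s - f' (A w) \<partial>P) = 0"
      using F'_integrable by (simp add: f'_eq P.prob_space)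
    finally show "(\<integral>s. ?h (A w, B w) s \<partial>P) = 0" by simp
  qed
  finally show "(\<integral>w. error A i w \<bullet> B w \<partial>M) = 0" by (simp add: error_def)
qed

end

section \<open>Asynchronous mini-batch mirror descent\<close>

text \<open>On the range of \<open>s\<close> the hypothesis makes \<open>z\<close> a Lipschitz function of \<open>s\<close>. The range itself need not
  be measurable, since it carries the trace of the Borel sets.\<close>

lemma measurable_of_lipschitz_relation:
  fixes s :: "'w \<Rightarrow> 'a::euclidean_space" and z :: "'w \<Rightarrow> 'b::euclidean_space"
  assumes s: "s \<in> borel_measurable M"
    and lip: "\<And>v w. v \<in> space M \<Longrightarrow> w \<in> space M \<Longrightarrow> norm (z v - z w) \<le> K * norm (s v - s w)"
  shows "z \<in> borel_measurable M"
proof -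
  define S where "S = s ` space M"
  define t where "t = (\<lambda>u. z (SOME w. w \<in> space M \<and> s w = u))"
  have t: "t (s w) = z w" if "w \<in> space M" for w
  proof -
    let ?v = "SOME v. v \<in> space M \<and> s v = s w"
    have "?v \<in> space M \<and> s ?v = s w" by (rule someI[of _ w]) (simp add: that)
    with lip[of ?v w] that show ?thesis by (simp add: t_def)
  qed
  have "norm (t u - t v) \<le> \<bar>K\<bar> * norm (u - v)" if uv: "u \<in> S" "v \<in> S" for u v
  proof -
    obtain w w' where w: "w \<in> space M" "u = s w" and w': "w' \<in> space M" "v = s w'"
      using uv unfolding S_def by auto
    have "norm (z w - z w') \<le> \<bar>K\<bar> * norm (s w - s w')"
      using lip[OF w(1) w'(1)] mult_right_mono[OF abs_ge_self[of K] norm_ge_zero[of "s w - s w'"]]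
      by linarith
    then show ?thesis using t w w' by simp
  qed
  then have "\<bar>K\<bar>-lipschitz_on S t" by (intro lipschitz_onI) (auto simp: dist_norm)
  then have "t \<in> borel_measurable (restrict_space borel S)"
    by (intro borel_measurable_continuous_on_restrict lipschitz_on_continuous_on)
  moreover have "s \<in> measurable M (restrict_space borel S)"
    using s by (intro measurable_restrict_space2) (auto simp: S_def)
  ultimately have "(\<lambda>w. t (s w)) \<in> borel_measurable M"
    by (rule measurable_compose[where f = s, rotated])
  moreover have "(\<lambda>w. t (s w)) \<in> borel_measurable M \<longleftrightarrow> z \<in> borel_measurable M"
    by (rule measurable_cong) (rule t)
  ultimately show ?thesis by blast
qed

locale async_mirror_descent =
  mirror_geometry N C \<psi> \<mu> \<omega> \<omega>' + gradient_oracle M P \<xi> "{1..b} \<times> UNIV" N F' f' L \<sigma>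
  for N :: "'a::euclidean_space \<Rightarrow> real" and C \<psi> \<mu> \<omega> \<omega>'
    and M :: "'w measure" and P :: "'s measure" and \<xi> :: "nat \<times> nat \<Rightarrow> 'w \<Rightarrow> 's" and b :: nat
    and F' f' L \<sigma> +
  fixes W :: "'a \<Rightarrow> real" and G \<theta> :: "'a \<Rightarrow> 'a" and f :: "'a \<Rightarrow> real" and Q :: real
    and \<tau> :: nat and d :: "nat \<Rightarrow> nat" and a :: "nat \<Rightarrow> real"
    and x0 y :: 'a and x :: "nat \<Rightarrow> 'w \<Rightarrow> 'a"
  assumes potential: "dual_potential N C \<omega> \<omega>' W G \<theta>"
    and f_smooth: "\<And>u z. f z \<le> f u + f' u \<bullet> (z - u) + L / 2 * (N (z - u))\<^sup>2"
    and f_gradient: "\<And>u z. f u + f' u \<bullet> (z - u) \<le> f z"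
    and L_nonneg: "0 \<le> L" and \<mu>_pos: "0 < \<mu>"
    and Q: "0 < Q" "\<And>u z. u \<in> C \<Longrightarrow> z \<in> C \<Longrightarrow> bregman \<omega> \<omega>' u z \<le> Q / 2 * (N (u - z))\<^sup>2"
    and y: "y \<in> C" and y_minimal: "\<And>z. z \<in> C \<Longrightarrow> f y + \<psi> y \<le> f z + \<psi> z"
    and b: "1 \<le> b"
    and d: "\<And>k. d k \<le> k" "\<And>k. k - d k \<le> \<tau>"
    and a: "\<And>k. a k = 2 * L * (real \<tau> + 1)\<^sup>2 + \<mu> / Q / 3 * (real k + real \<tau> + 1)"
    and x0: "x0 \<in> C" and x_0: "\<And>w. w \<in> space M \<Longrightarrow> x 0 w = x0"
    and x_Suc: "\<And>k w. w \<in> space M \<Longrightarrow>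
      mirror_step (a k) (batch_grad F' b (\<lambda>i. \<xi> (i, k) w) (x (d k) w)) (x k w) (x (Suc k) w)"
begin

definition seen :: "nat \<Rightarrow> (nat \<times> nat) set" where
  "seen k = {1..b} \<times> {..<k}"

lemma a_pos: "0 < a k"
  unfolding a using L_nonneg \<mu>_pos Q(1) by (intro add_nonneg_pos) auto

lemma x_in_C:
  assumes "w \<in> space M"
  shows "x k w \<in> C"
proof (cases k)
  case 0
  then show ?thesis using x_0[OF assms] x0 by simp
next
  case (Suc j)
  then show ?thesis using x_Suc[OF assms, of j] by (simp add: mirror_step_def)
qed

lemma continuous_compose_iterate_measurable:
  fixes h :: "'a \<Rightarrow> 'a"
  assumes "continuous_on C h" "x k \<in> borel_measurable M'" "space M' = space M"
  shows "(\<lambda>w. h (x k w)) \<in> borel_measurable M'"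
proof -
  have "x k \<in> measurable M' (restrict_space borel C)"
    using assms(2,3) x_in_C by (intro measurable_restrict_space2) auto
  then show ?thesis
    by (rule measurable_compose[OF _ borel_measurable_continuous_on_restrict[OF assms(1)]])
qed

text \<open>By induction along the run; only samples of the batches before \<open>k\<close> enter \<open>x k\<close>.\<close>

lemma iterate_measurable: "x k \<in> borel_measurable (history (seen k))"
proof (induction k rule: less_induct)
  case (less k)
  show ?case
  proof (cases k)
    case 0
    have "x 0 \<in> borel_measurable (history (seen 0)) \<longleftrightarrow> (\<lambda>w. x0) \<in> borel_measurable (history (seen 0))"
      using x_0 by (intro measurable_cong) simp
    then show ?thesis using 0 by simp
  next
    case (Suc m)
    have cont_\<omega>': "continuous_on C \<omega>'" using dgf unfolding distance_generating_def by blast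
    let ?H = "history (seen k)"
    have past: "x j \<in> borel_measurable ?H" if "j \<le> m" for j
      using that Suc
      by (intro measurable_history_mono[OF less.IH]) (auto simp: seen_def)
    have \<xi>_meas: "\<xi> (i, m) \<in> measurable ?H P" if "i \<in> {1..b}" for i
      using that Suc by (intro \<xi>_measurable_history) (auto simp: seen_def)
    define s where "s = (\<lambda>w. batch_grad F' b (\<lambda>i. \<xi> (i, m) w) (x (d m) w) - a m *\<^sub>R \<omega>' (x m w))"
    have "(\<lambda>w. F' (x (d m) w) (\<xi> (i, m) w)) \<in> borel_measurable ?H" if "i \<in> {1..b}" for i
    proof -
      note [measurable] = past[OF d(1)] \<xi>_meas[OF that]
      show ?thesis by measurable
    qed
    moreover have "(\<lambda>w. \<omega>' (x m w)) \<in> borel_measurable ?H"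
      by (rule continuous_compose_iterate_measurable[OF cont_\<omega>' past]) simp_all
    ultimately have s: "s \<in> borel_measurable ?H"
      unfolding s_def batch_grad_def
      by (intro borel_measurable_diff borel_measurable_scaleR borel_measurable_sum) auto
    obtain c where c: "0 < c" "\<And>v. c * norm v \<le> N v"
      using is_norm_equivalent_norm[OF N_norm] by metis
    obtain K where K: "\<And>v. dual_norm N v \<le> K * norm v"
      using dual_norm_le_norm[OF N_norm] by metis
    have "norm (x k v - x k w) \<le> K / (a m * c) * norm (s v - s w)"
      if "v \<in> space M" "w \<in> space M" for v w
    proof -
      have "a m * (c * norm (x k v - x k w)) \<le> a m * N (x k v - x k w)"
        using c(2) a_pos[of m] by simp
      also have "\<dots> \<le> dual_norm N (s v - s w)"
        unfolding s_def Suc by (rule mirror_step_lipschitz[OF a_pos x_Suc x_Suc]) (use that in auto)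
      also have "\<dots> \<le> K * norm (s v - s w)" by (rule K)
      finally show ?thesis using a_pos[of m] c(1) by (simp add: field_simps)
    qed
    then show ?thesis
      by (intro measurable_of_lipschitz_relation[OF s, where K = "K / (a m * c)"]) simp_all
  qed
qed

lemma iterate_measurable_M [measurable]: "x k \<in> borel_measurable M"
  by (rule measurable_from_history[OF iterate_measurable]) (auto simp: seen_def)

definition sample_error :: "nat \<Rightarrow> nat \<Rightarrow> 'w \<Rightarrow> 'a" where
  "sample_error k i = error (x (d k)) (i, k)"

text \<open>The bound of \<open>dual_potential_noise_bound\<close> with \<open>\<kappa> = a k / 2\<close>, the share of the Bregman term that
  is set aside for the noise.\<close>

definition noise :: "nat \<Rightarrow> 'w \<Rightarrow> real" where
  "noise k w = (\<Sum>i=1..b.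
     1 / real b * (sample_error k i w \<bullet>
       (y - G (\<theta> (x k w) - (1 / (a k / 2 * real b)) *\<^sub>R (\<Sum>l\<in>{1..<i}. sample_error k l w))))
     + (dual_norm N (sample_error k i w))\<^sup>2 / (2 * (a k / 2) * (real b)\<^sup>2))"

lemma batch_gradient_error:
  "batch_grad F' b (\<lambda>i. \<xi> (i, k) w) (x (d k) w) - f' (x (d k) w) =
     (1 / real b) *\<^sub>R (\<Sum>i=1..b. sample_error k i w)"
  using b by (simp add: batch_grad_def sample_error_def error_def sum_subtractf scaleR_diff_right
      sum_constant_scaleR)

lemma one_step_inequality:
  assumes w: "w \<in> space M"
  shows "(a k + \<mu> / Q) * D (x (Suc k) w) y \<le> a k * D (x k w) y
    + L / 2 * (N (x (Suc k) w - x (d k) w))\<^sup>2 - a k / 4 * (N (x (Suc k) w - x k w))\<^sup>2 + noise k w"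
proof -
  let ?g = "batch_grad F' b (\<lambda>i. \<xi> (i, k) w) (x (d k) w)"
  let ?u = "x (d k) w" and ?x = "x k w" and ?z = "x (Suc k) w"
  define e where "e = (1 / real b) *\<^sub>R (\<Sum>i=1..b. sample_error k i w)"
  have g: "?g = f' ?u + e" using batch_gradient_error[of k w] by (simp add: e_def algebra_simps)
  have x: "?x \<in> C" and z: "?z \<in> C" using x_in_C[OF w] by auto
  have "?g \<bullet> (?z - y) + \<psi> ?z - \<psi> y + \<mu> / 2 * (N (y - ?z))\<^sup>2 + a k * D ?z y + a k * D ?x ?z \<le> a k * D ?x y"
    by (rule mirror_step_inequality[OF a_pos x_Suc[OF w] y])
  moreover have "\<mu> / Q * D ?z y \<le> \<mu> / 2 * (N (y - ?z))\<^sup>2"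
    using mult_left_mono[OF Q(2)[OF z y], of "\<mu> / Q"] Q(1) \<mu>_pos
      is_norm_minus_commute[OF N_norm, of y ?z] by simp
  moreover have "a k / 4 * (N (?z - ?x))\<^sup>2 \<le> a k / 2 * D ?x ?z"
    using mult_left_mono[OF bregman_lower_bound[OF dgf x z], of "a k / 2"] a_pos[of k] by simp
  moreover have "- (e \<bullet> (?z - y)) - a k / 2 * D ?x ?z \<le> noise k w"
    unfolding noise_def e_def
    by (rule dual_potential_noise_bound[OF N_norm potential _ b x z]) (use a_pos[of k] in simp)
  moreover have "0 \<le> f' ?u \<bullet> (?z - y) + L / 2 * (N (?z - ?u))\<^sup>2 + \<psi> ?z - \<psi> y"
    using f_smooth[of ?z ?u] f_gradient[of ?u y] y_minimal[OF z]
    by (simp add: inner_diff_right)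
  ultimately show ?thesis by (simp add: g inner_add_left algebra_simps)
qed

lemma pathwise_bound:
  assumes w: "w \<in> space M"
  shows "(a T)\<^sup>2 * D (x T w) y \<le> (a 0)\<^sup>2 * D x0 y + (\<Sum>k<T. a k * noise k w)"
proof -
  have "0 \<le> D (x k w) y" for k
    using bregman_lower_bound[OF dgf x_in_C[OF w] y, of k] zero_le_power2[of "N (y - x k w)"]
    by linarith
  moreover have "0 \<le> \<mu> / Q" using \<mu>_pos Q(1) by simp
  ultimately show ?thesis
    using delayed_weighted_recursion[OF N_norm L_nonneg _ a d,
        of "\<lambda>k. D (x k w) y" "\<lambda>k. x k w" "\<lambda>k. noise k w" T]
      one_step_inequality[OF w] x_0[OF w] by simp
qed

text \<open>For sample \<open>i\<close> of batch \<open>k\<close>, the past consists of all earlier batches and of the samples before \<open>i\<close>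
  in the same batch. The first-order terms vanish against it, and the \<open>b\<close> second-order terms contribute
  \<open>\<sigma>^2 / (a k b^2)\<close> each. Square integrability of the iterate is needed for the first-order terms to be
  integrable at all.\<close>

lemma noise_expectation:
  assumes int: "integrable M (\<lambda>w. (norm (x k w - y))\<^sup>2)"
  shows "integrable M (noise k)" and "(\<integral>w. noise k w \<partial>M) \<le> \<sigma>\<^sup>2 / (a k * real b)"
proof -
  define J where "J = (\<lambda>i. seen k \<union> {1..<i} \<times> {k})"
  define c where "c = 1 / (a k / 2 * real b)"
  define B where "B = (\<lambda>i w. y - G (\<theta> (x k w) - c *\<^sub>R (\<Sum>l\<in>{1..<i}. sample_error k l w)))"
  obtain K where K: "\<And>s t. norm (G s - G t) \<le> K * norm (s - t)"
    using potential unfolding dual_potential_def by blast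
  have cont_\<theta>: "continuous_on C \<theta>" using potential unfolding dual_potential_def by blast
  have G_meas: "G \<in> borel_measurable borel"
    by (rule measurable_of_lipschitz_relation[where s = "\<lambda>s. s" and K = K]) (simp_all add: K)
  have J: "J i \<subseteq> {1..b} \<times> UNIV" "(i, k) \<in> {1..b} \<times> UNIV" "(i, k) \<notin> J i" if "i \<in> {1..b}" for i
    using that by (auto simp: J_def seen_def)
  have past: "x j \<in> borel_measurable (history (J i))" if "i \<in> {1..b}" "j \<le> k" for i j
    using that by (intro measurable_history_mono[OF iterate_measurable]) (auto simp: J_def seen_def)
  note A = past[OF _ d(1)]
  have err_meas: "sample_error k l \<in> borel_measurable (history (J i))"
    if "i \<in> {1..b}" "l \<in> {1..<i}" for i l
    unfolding sample_error_def
    by (intro error_measurable A \<xi>_measurable_history J) (use that in \<open>auto simp: J_def\<close>)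
  have B_meas: "B i \<in> borel_measurable (history (J i))" if i: "i \<in> {1..b}" for i
  proof -
    have [measurable]: "(\<lambda>w. \<theta> (x k w)) \<in> borel_measurable (history (J i))"
      by (rule continuous_compose_iterate_measurable[OF cont_\<theta> past[OF i]]) simp_all
    have [measurable]: "(\<lambda>w. \<Sum>l\<in>{1..<i}. sample_error k l w) \<in> borel_measurable (history (J i))"
      by (intro borel_measurable_sum err_meas[OF i])
    note [measurable] = G_meas
    show ?thesis unfolding B_def by measurable
  qed
  have B_int: "integrable M (\<lambda>w. (norm (B i w))\<^sup>2)" if i: "i \<in> {1..b}" for i
  proof -
    let ?S = "\<lambda>w. \<Sum>l\<in>{1..<i}. sample_error k l w"
    have BM: "B i \<in> borel_measurable M" using B_meas[OF i] J(1)[OF i] by (rule measurable_from_history)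
    have "integrable M (\<lambda>w. (norm (?S w))\<^sup>2)"
    proof (rule square_integrable_sum)
      fix l assume l: "l \<in> {1..<i}"
      then have lb: "l \<in> {1..b}" using i by auto
      show "sample_error k l \<in> borel_measurable M"
        using err_meas[OF i l] J(1)[OF i] by (rule measurable_from_history)
      show "integrable M (\<lambda>w. (norm (sample_error k l w))\<^sup>2)"
        unfolding sample_error_def by (rule square_integrable_error[OF A[OF lb] J[OF lb]])
    qed simp
    moreover have "norm (B i w - (y - x k w)) \<le> (K * \<bar>c\<bar>) * norm (?S w)" if "w \<in> space M" for w
    proof -
      have "G (\<theta> (x k w)) = x k w"
        using potential x_in_C[OF that] unfolding dual_potential_def by blast
      then have "B i w - (y - x k w) = G (\<theta> (x k w)) - G (\<theta> (x k w) - c *\<^sub>R ?S w)"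
        by (simp add: B_def)
      also have "norm \<dots> \<le> K * norm (\<theta> (x k w) - (\<theta> (x k w) - c *\<^sub>R ?S w))" by (rule K)
      finally show ?thesis by simp
    qed
    ultimately have "integrable M (\<lambda>w. (norm (B i w - (y - x k w)))\<^sup>2)"
      using BM by - (rule square_integrable_norm_le[where h = ?S and K = "K * \<bar>c\<bar>"], auto)
    moreover have "integrable M (\<lambda>w. (norm (y - x k w))\<^sup>2)"
      using int by (simp add: norm_minus_commute)
    ultimately have "integrable M (\<lambda>w. (norm ((B i w - (y - x k w)) + (y - x k w)))\<^sup>2)"
      using BM by (intro square_integrable_add) auto
    then show ?thesis by simp
  qed
  have dual_int: "integrable M (\<lambda>w. (dual_norm N (sample_error k i w))\<^sup>2)"
    and dual_le: "(\<integral>w. (dual_norm N (sample_error k i w))\<^sup>2 \<partial>M) \<le> \<sigma>\<^sup>2" if i: "i \<in> {1..b}" for i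
    unfolding sample_error_def by (rule integrable_error_dual_norm[OF A[OF i] J[OF i]])+
  have cross_int: "integrable M (\<lambda>w. sample_error k i w \<bullet> B i w)"
    and cross: "(\<integral>w. sample_error k i w \<bullet> B i w \<partial>M) = 0" if i: "i \<in> {1..b}" for i
    unfolding sample_error_def
    by (rule error_orthogonal_past[OF A[OF i] J[OF i] B_meas[OF i] B_int[OF i]])+
  have noise: "noise k = (\<lambda>w. \<Sum>i=1..b. 1 / real b * (sample_error k i w \<bullet> B i w)
      + (dual_norm N (sample_error k i w))\<^sup>2 / (a k * (real b)\<^sup>2))"
    by (rule ext) (simp add: noise_def B_def c_def)
  show "integrable M (noise k)"
    unfolding noise using cross_int dual_int by auto
  have "(\<integral>w. noise k w \<partial>M) = (\<Sum>i=1..b. 1 / real b * (\<integral>w. sample_error k i w \<bullet> B i w \<partial>M)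
      + (\<integral>w. (dual_norm N (sample_error k i w))\<^sup>2 \<partial>M) / (a k * (real b)\<^sup>2))"
    unfolding noise using cross_int dual_int by (simp add: Bochner_Integration.integral_sum)
  also have "\<dots> \<le> (\<Sum>i=1..b. \<sigma>\<^sup>2 / (a k * (real b)\<^sup>2))"
    using cross dual_le a_pos[of k] b by (intro sum_mono) (auto intro!: divide_right_mono)
  also have "\<dots> = \<sigma>\<^sup>2 / (a k * real b)"
    using b by (simp add: power2_eq_square)
  finally show "(\<integral>w. noise k w \<partial>M) \<le> \<sigma>\<^sup>2 / (a k * real b)" .
qed

lemma square_distance_bound:
  assumes w: "w \<in> space M"
  shows "(N (x T w - y))\<^sup>2 \<le> 2 / (a T)\<^sup>2 * ((a 0)\<^sup>2 * D x0 y + (\<Sum>k<T. a k * noise k w))"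
proof -
  have "1 / 2 * (N (x T w - y))\<^sup>2 \<le> D (x T w) y"
    using bregman_lower_bound[OF dgf x_in_C[OF w] y] is_norm_minus_commute[OF N_norm] by metis
  then have "(a T)\<^sup>2 * (1 / 2 * (N (x T w - y))\<^sup>2) \<le> (a T)\<^sup>2 * D (x T w) y"
    by (rule mult_left_mono) simp
  also note pathwise_bound[OF w]
  finally show ?thesis using a_pos[of T] by (simp add: field_simps)
qed

lemma square_integrable_iterate:
  assumes "integrable M (\<lambda>w. (N (x k w - y))\<^sup>2)"
  shows "integrable M (\<lambda>w. (norm (x k w - y))\<^sup>2)"
proof -
  obtain c where c: "0 < c" "\<And>v. c * norm v \<le> N v"
    using is_norm_equivalent_norm[OF N_norm] by metis
  show ?thesis
  proof (rule square_integrable_norm_le[where h = "\<lambda>w. N (x k w - y)" and K = "1 / c"])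
    show "integrable M (\<lambda>w. (norm (N (x k w - y)))\<^sup>2)" using assms by simp
    show "norm (x k w - y) \<le> 1 / c * norm (N (x k w - y))" for w
      using c is_norm_nonneg[OF N_norm] by (simp add: field_simps)
  qed measurable
qed

text \<open>The pathwise bound on \<open>x T\<close> involves only the noise of steps before \<open>T\<close>, whose integrability
  follows from that of the iterates before \<open>T\<close>.\<close>

lemma square_distance_integrable: "integrable M (\<lambda>w. (N (x T w - y))\<^sup>2)"
proof (induction T rule: less_induct)
  case (less T)
  have noise_int: "integrable M (noise k)" if "k < T" for k
    by (rule noise_expectation(1)[OF square_integrable_iterate[OF less.IH[OF that]]])
  show ?case
  proof (rule Bochner_Integration.integrable_bound)
    show "integrable M (\<lambda>w. 2 / (a T)\<^sup>2 * ((a 0)\<^sup>2 * D x0 y + (\<Sum>k<T. a k * noise k w)))"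
      using noise_int by (intro integrable_mult_right Bochner_Integration.integrable_add
          Bochner_Integration.integrable_sum) auto
    show "AE w in M. norm ((N (x T w - y))\<^sup>2) \<le>
        norm (2 / (a T)\<^sup>2 * ((a 0)\<^sup>2 * D x0 y + (\<Sum>k<T. a k * noise k w)))"
      using square_distance_bound[of _ T] by (intro AE_I2) (smt (verit) real_norm_def zero_le_power2)
  qed measurable
qed

theorem expected_square_distance:
  "(\<integral>w. (N (x T w - y))\<^sup>2 \<partial>M) \<le>
     2 / (a T)\<^sup>2 * ((a 0)\<^sup>2 * D x0 y + real T * (\<sigma>\<^sup>2 / real b))"
proof -
  note sq = square_integrable_iterate[OF square_distance_integrable]
  note noise_int = noise_expectation(1)[OF sq]
  have "(\<integral>w. (N (x T w - y))\<^sup>2 \<partial>M) \<le>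
      (\<integral>w. 2 / (a T)\<^sup>2 * ((a 0)\<^sup>2 * D x0 y + (\<Sum>k<T. a k * noise k w)) \<partial>M)"
    using noise_int square_distance_bound
    by (intro integral_mono square_distance_integrable integrable_mult_right
        Bochner_Integration.integrable_add Bochner_Integration.integrable_sum) auto
  also have "\<dots> = 2 / (a T)\<^sup>2 * ((a 0)\<^sup>2 * D x0 y + (\<Sum>k<T. a k * (\<integral>w. noise k w \<partial>M)))"
    using noise_int by (simp add: Bochner_Integration.integral_add Bochner_Integration.integral_sum prob_space)
  also have "\<dots> \<le> 2 / (a T)\<^sup>2 * ((a 0)\<^sup>2 * D x0 y + (\<Sum>k<T. \<sigma>\<^sup>2 / real b))"
  proof (intro mult_left_mono add_left_mono sum_mono)
    fix k
    have "a k * (\<integral>w. noise k w \<partial>M) \<le> a k * (\<sigma>\<^sup>2 / (a k * real b))"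
      using a_pos[of k] by (intro mult_left_mono noise_expectation(2)[OF sq]) auto
    then show "a k * (\<integral>w. noise k w \<partial>M) \<le> \<sigma>\<^sup>2 / real b" using a_pos[of k] by simp
  qed simp
  finally show ?thesis by simp
qed

end

section \<open>Extended-valued regularizers\<close>

lemma proper_fun_eq_real:
  "proper_fun \<Psi> \<Longrightarrow> z \<in> eff_dom \<Psi> \<Longrightarrow> \<Psi> z = ereal (real_of_ereal (\<Psi> z))"
  unfolding proper_fun_def eff_dom_def by (cases "\<Psi> z") auto

lemma convex_eff_dom:
  assumes "proper_fun \<Psi>" "convex_fun \<Psi>"
  shows "convex (eff_dom \<Psi>)" and "convex_on (eff_dom \<Psi>) (\<lambda>z. real_of_ereal (\<Psi> z))"
proof -
  have le: "\<Psi> (u *\<^sub>R x + v *\<^sub>R y) \<le> ereal (u * real_of_ereal (\<Psi> x) + v * real_of_ereal (\<Psi> y))"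
    if "x \<in> eff_dom \<Psi>" "y \<in> eff_dom \<Psi>" "0 \<le> u" "0 \<le> v" "u + v = 1" for x y u v
  proof -
    have "\<Psi> (u *\<^sub>R x + v *\<^sub>R y) \<le> ereal u * \<Psi> x + ereal v * \<Psi> y"
      using assms(2) that unfolding convex_fun_def by blast
    also have "\<dots> = ereal (u * real_of_ereal (\<Psi> x) + v * real_of_ereal (\<Psi> y))"
      using proper_fun_eq_real[OF assms(1) that(1)] proper_fun_eq_real[OF assms(1) that(2)]
      by (metis plus_ereal.simps(1) times_ereal.simps(1))
    finally show ?thesis .
  qed
  show conv: "convex (eff_dom \<Psi>)"
    unfolding convex_def
  proof (intro ballI allI impI)
    fix x y u v assume "x \<in> eff_dom \<Psi>" "y \<in> eff_dom \<Psi>" "0 \<le> (u::real)" "0 \<le> v" "u + v = 1"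
    from le[OF this] show "u *\<^sub>R x + v *\<^sub>R y \<in> eff_dom \<Psi>"
      unfolding eff_dom_def by (auto intro: order.strict_trans1)
  qed
  show "convex_on (eff_dom \<Psi>) (\<lambda>z. real_of_ereal (\<Psi> z))"
    unfolding convex_on_def
  proof (intro conjI conv ballI allI impI)
    fix x y u v assume *: "x \<in> eff_dom \<Psi>" "y \<in> eff_dom \<Psi>" "0 \<le> (u::real)" "0 \<le> v" "u + v = 1"
    have "u *\<^sub>R x + v *\<^sub>R y \<in> eff_dom \<Psi>" using conv * unfolding convex_def by blast
    from proper_fun_eq_real[OF assms(1) this] le[OF *]
    show "real_of_ereal (\<Psi> (u *\<^sub>R x + v *\<^sub>R y)) \<le> u * real_of_ereal (\<Psi> x) + v * real_of_ereal (\<Psi> y)"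
      by (metis ereal_less_eq(3))
  qed
qed

lemma strongly_convex_fun_real:
  assumes proper: "proper_fun \<Psi>" and strong: "strongly_convex_fun N \<mu> \<Psi>"
    and x: "x \<in> eff_dom \<Psi>" and y: "y \<in> eff_dom \<Psi>"
    and sub: "\<And>z. z \<in> eff_dom \<Psi> \<Longrightarrow> real_of_ereal (\<Psi> x) + s \<bullet> (z - x) \<le> real_of_ereal (\<Psi> z)"
  shows "real_of_ereal (\<Psi> x) + s \<bullet> (y - x) + \<mu> / 2 * (N (y - x))\<^sup>2 \<le> real_of_ereal (\<Psi> y)"
proof -
  obtain r where r: "\<Psi> x = ereal r" using proper_fun_eq_real[OF proper x] by blast
  obtain q where q: "\<Psi> y = ereal q" using proper_fun_eq_real[OF proper y] by blast
  have "\<Psi> z \<ge> \<Psi> x + ereal (s \<bullet> (z - x))" for z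
  proof (cases "z \<in> eff_dom \<Psi>")
    case True
    then show ?thesis using proper_fun_eq_real[OF proper True] sub[OF True] r
      by (metis ereal_less_eq(3) plus_ereal.simps(1) real_of_ereal.simps(1))
  next
    case False
    then show ?thesis by (simp add: eff_dom_def)
  qed
  then have "s \<in> subdifferential \<Psi> x" unfolding subdifferential_def by blast
  then have "\<Psi> y \<ge> \<Psi> x + ereal (s \<bullet> (y - x)) + ereal (\<mu> / 2 * (N (y - x))\<^sup>2)"
    using strong x y unfolding strongly_convex_fun_def by blast
  then show ?thesis by (simp add: r q)
qed

lemma arg_min_in_eff_dom:
  assumes proper: "proper_fun \<Psi>"
    and min: "is_arg_min (\<lambda>z. ereal (p z) + \<Psi> z + ereal (q z)) (\<lambda>z. True) z"
  shows "z \<in> eff_dom \<Psi>"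
    and "y \<in> eff_dom \<Psi> \<Longrightarrow>
      p z + real_of_ereal (\<Psi> z) + q z \<le> p y + real_of_ereal (\<Psi> y) + q y"
proof -
  have le: "ereal (p z) + \<Psi> z + ereal (q z) \<le> ereal (p y) + \<Psi> y + ereal (q y)" for y
    using min unfolding is_arg_min_def by (simp add: not_less)
  obtain v where v: "v \<in> eff_dom \<Psi>" using proper unfolding proper_fun_def by blast
  show z: "z \<in> eff_dom \<Psi>"
    using le[of v] v proper unfolding eff_dom_def proper_fun_def
    by (cases "\<Psi> v"; cases "\<Psi> z") auto
  show "p z + real_of_ereal (\<Psi> z) + q z \<le> p y + real_of_ereal (\<Psi> y) + q y"
    if "y \<in> eff_dom \<Psi>"
    using le[of y] z that proper unfolding eff_dom_def proper_fun_def
    by (cases "\<Psi> y"; cases "\<Psi> z") auto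
qed

section \<open>Convergence rate\<close>

text \<open>Both \<open>a 0\<close> and \<open>a T\<close> are compared with multiples of \<open>\<mu> / (3 Q)\<close>: the first is at most
  \<open>(6 L Q / \<mu> + 1) (\<tau> + 1)^2\<close> times it, the second at least \<open>T + 1\<close> times it.\<close>

lemma rate_constants:
  fixes L Q \<mu> \<sigma> c V :: real and T \<tau> b :: nat
  assumes pos: "0 \<le> L" "0 < \<mu>" "0 < Q" "1 \<le> c" "1 \<le> b" "0 \<le> V"
    and a: "\<And>k. a k = 2 * L * (real \<tau> + 1)\<^sup>2 + \<mu> / Q / 3 * (real k + real \<tau> + 1)"
  shows "2 / (a T)\<^sup>2 * ((a 0)\<^sup>2 * V + real T * (\<sigma>\<^sup>2 / real b)) \<le>
    2 * (6 * L * Q / \<mu> + 1)\<^sup>2 * (real \<tau> + 1) ^ 4 / (real T + 1)\<^sup>2 * V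
      + 18 * c * \<sigma>\<^sup>2 * Q\<^sup>2 / (real b * \<mu>\<^sup>2 * (real T + 1))"
proof -
  define q where "q = \<mu> / Q / 3"
  have q: "0 < q" using pos by (simp add: q_def)
  define R where "R = (6 * L * Q / \<mu> + 1) * (real \<tau> + 1)\<^sup>2"
  have R: "0 \<le> R" using pos by (simp add: R_def)
  have a0: "a 0 \<le> q * R"
  proof -
    have "(real \<tau> + 1) \<le> (real \<tau> + 1)\<^sup>2" by (simp add: power2_eq_square algebra_simps)
    then have "q * (real \<tau> + 1) \<le> q * (real \<tau> + 1)\<^sup>2" using q by simp
    moreover have "2 * L = q * (6 * L * Q / \<mu>)" using pos by (simp add: q_def)
    ultimately show ?thesis unfolding a R_def q_def[symmetric] by (simp add: algebra_simps)
  qed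
  have a0_nonneg: "0 \<le> a 0" unfolding a using pos by simp
  have aT: "q * (real T + 1) \<le> a T"
    unfolding a q_def[symmetric] using pos q by (simp add: algebra_simps)
  have pos_aT: "0 < q * (real T + 1)" using q by simp
  have "(q * (real T + 1))\<^sup>2 \<le> (a T)\<^sup>2" using aT pos_aT by (intro power_mono) auto
  moreover have "0 < (q * (real T + 1))\<^sup>2" using pos_aT by (rule zero_less_power)
  ultimately have inv: "1 / (a T)\<^sup>2 \<le> 1 / (q * (real T + 1))\<^sup>2" by (intro frac_le) simp_all
  have "(a 0)\<^sup>2 \<le> (q * R)\<^sup>2" using a0 a0_nonneg by (rule power_mono)
  then have "(a 0)\<^sup>2 * V + real T * (\<sigma>\<^sup>2 / real b) \<le> (q * R)\<^sup>2 * V + real T * (\<sigma>\<^sup>2 / real b)"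
    using pos(6) by (simp add: mult_right_mono)
  moreover have "real T * (\<sigma>\<^sup>2 / real b) \<le> (real T + 1) * (c * \<sigma>\<^sup>2 / real b)"
  proof (intro mult_mono divide_right_mono)
    show "\<sigma>\<^sup>2 \<le> c * \<sigma>\<^sup>2" using mult_right_mono[OF pos(4), of "\<sigma>\<^sup>2"] by simp
  qed auto
  ultimately have "(a 0)\<^sup>2 * V + real T * (\<sigma>\<^sup>2 / real b) \<le>
      (q * R)\<^sup>2 * V + (real T + 1) * (c * \<sigma>\<^sup>2 / real b)" by linarith
  then have "1 / (a T)\<^sup>2 * ((a 0)\<^sup>2 * V + real T * (\<sigma>\<^sup>2 / real b)) \<le>
      1 / (q * (real T + 1))\<^sup>2 * ((q * R)\<^sup>2 * V + (real T + 1) * (c * \<sigma>\<^sup>2 / real b))"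
    using inv pos by (intro mult_mono) auto
  also have "\<dots> = R\<^sup>2 / (real T + 1)\<^sup>2 * V + c * \<sigma>\<^sup>2 / (q\<^sup>2 * real b * (real T + 1))"
  proof -
    have "1 / (q * t)\<^sup>2 * ((q * R)\<^sup>2 * V + t * (c * \<sigma>\<^sup>2 / real b)) =
        R\<^sup>2 / t\<^sup>2 * V + c * \<sigma>\<^sup>2 / (q\<^sup>2 * real b * t)" if "0 < t" for t
      using q pos(5) that by (simp add: field_simps power2_eq_square)
    then show ?thesis by simp
  qed
  also have "R\<^sup>2 = (6 * L * Q / \<mu> + 1)\<^sup>2 * (real \<tau> + 1) ^ 4"
    by (simp add: R_def power_mult_distrib flip: power_mult)
  also have "c * \<sigma>\<^sup>2 / (q\<^sup>2 * real b * (real T + 1)) =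
      9 * c * \<sigma>\<^sup>2 * Q\<^sup>2 / (real b * \<mu>\<^sup>2 * (real T + 1))"
    using pos by (simp add: q_def power_divide field_simps)
  finally have "2 * (1 / (a T)\<^sup>2 * ((a 0)\<^sup>2 * V + real T * (\<sigma>\<^sup>2 / real b))) \<le>
      2 * ((6 * L * Q / \<mu> + 1)\<^sup>2 * (real \<tau> + 1) ^ 4 / (real T + 1)\<^sup>2 * V
        + 9 * c * \<sigma>\<^sup>2 * Q\<^sup>2 / (real b * \<mu>\<^sup>2 * (real T + 1)))"
    by (rule mult_left_mono) simp
  then show ?thesis by (simp add: distrib_left mult.assoc)
qed

theorem theorem3:
  fixes N :: "real ^ 'n \<Rightarrow> real"
    and P :: "(real ^ 'm) measure" and \<Xi> :: "(real ^ 'm) set"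
    and F :: "real ^ 'n \<Rightarrow> real ^ 'm \<Rightarrow> real"
    and F' :: "real ^ 'n \<Rightarrow> real ^ 'm \<Rightarrow> real ^ 'n"
    and f :: "real ^ 'n \<Rightarrow> real" and f' :: "real ^ 'n \<Rightarrow> real ^ 'n"
    and \<Psi> :: "real ^ 'n \<Rightarrow> ereal"
    and X :: "(real ^ 'n) set"
    and \<omega> :: "real ^ 'n \<Rightarrow> real" and \<omega>' :: "real ^ 'n \<Rightarrow> real ^ 'n"
    and L \<sigma> \<mu> Q c :: real
    and b \<tau>max :: nat and d :: "nat \<Rightarrow> nat" and \<beta> \<gamma> :: "nat \<Rightarrow> real"
    and M :: "'w measure" and \<xi> :: "nat \<Rightarrow> nat \<Rightarrow> 'w \<Rightarrow> real ^ 'm"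
    and x0 xstar :: "real ^ 'n" and x :: "nat \<Rightarrow> 'w \<Rightarrow> real ^ 'n"
  assumes norm: "is_norm N"
    \<comment> \<open>stochastic loss\<close>
    and P: "prob_space P" "sets P = sets (restrict_space borel \<Xi>)"
    and F_convex: "\<And>s. s \<in> \<Xi> \<Longrightarrow> convex_on UNIV (\<lambda>y. F y s)"
    and F_grad: "\<And>s y. s \<in> \<Xi> \<Longrightarrow> GDERIV (\<lambda>z. F z s) y :> F' y s"
    and F_integrable: "\<And>y. integrable P (F y)"
    and f: "\<And>y. f y = (\<integral>s. F y s \<partial>P)"
    and f_convex: "convex_on UNIV f"
    and F'_integrable: "\<And>y. integrable P (F' y)"
    and f': "\<And>y. f' y = (\<integral>s. F' y s \<partial>P)"
    and f_grad: "\<And>y. GDERIV f y :> f' y"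
    and F_smooth: "\<And>s y z. s \<in> \<Xi> \<Longrightarrow> dual_norm N (F' y s - F' z s) \<le> L * N (y - z)"
    and sigma: "0 \<le> \<sigma>"
    and variance: "\<And>y. (\<integral>\<^sup>+s. ennreal ((dual_norm N (F' y s - f' y))\<^sup>2) \<partial>P) \<le> ennreal (\<sigma>\<^sup>2)"
    \<comment> \<open>regularizer\<close>
    and Psi: "proper_fun \<Psi>" "convex_fun \<Psi>" "lower_semicont \<Psi>" "closed (eff_dom \<Psi>)"
    and Psi_strong: "0 < \<mu>" "strongly_convex_fun N \<mu> \<Psi>"
    \<comment> \<open>distance generating function\<close>
    and omega: "eff_dom \<Psi> \<subseteq> X" "distance_generating N X \<omega> \<omega>'"
    and Q: "1 \<le> Q"
      "\<And>y z. y \<in> eff_dom \<Psi> \<Longrightarrow> z \<in> eff_dom \<Psi> \<Longrightarrow> bregman \<omega> \<omega>' y z \<le> Q / 2 * (N (y - z))\<^sup>2"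
    and X_UNIV: "dual_norm N \<noteq> norm \<Longrightarrow> X = UNIV"
    and c: "c = variance_const N \<omega>" "1 \<le> c" "c \<le> real b"
    \<comment> \<open>minimizer\<close>
    and xstar: "is_arg_min (\<lambda>y. ereal (f y) + \<Psi> y) (\<lambda>y. True) xstar"
    \<comment> \<open>algorithm\<close>
    and b: "1 \<le> b"
    and delays: "\<And>k. d k \<le> k" "\<And>k. k - d k \<le> \<tau>max"
    and beta: "\<And>k. \<beta> k = \<mu> / (3 * Q) * (real k + real \<tau>max + 1)"
    and gamma: "\<And>k. 0 < \<gamma> k" "\<And>k. inverse (\<gamma> k) = 2 * L * (real \<tau>max + 1)\<^sup>2 + \<beta> k"
    and x0: "x0 \<in> eff_dom \<Psi>"
    and M: "prob_space M"
    and samples_indep: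
      "prob_space.indep_vars M (\<lambda>_. P) (\<lambda>(i, k). \<xi> i k) ({1..b} \<times> UNIV)"
    and samples_distr: "\<And>i k. i \<in> {1..b} \<Longrightarrow> distr M P (\<xi> i k) = P"
    and run: "\<And>w. w \<in> space M \<Longrightarrow>
      async_minibatch_run F' \<Psi> \<omega> \<omega>' b \<gamma> d x0 (\<lambda>i k. \<xi> i k w) (\<lambda>k. x k w)"
  shows "\<forall>T\<ge>1. integrable M (\<lambda>w. (N (x T w - xstar))\<^sup>2) \<and>
      (\<integral>w. (N (x T w - xstar))\<^sup>2 \<partial>M)
        \<le> 2 * (6 * L * Q / \<mu> + 1)\<^sup>2 * (real \<tau>max + 1) ^ 4 / (real T + 1)\<^sup>2 * bregman \<omega> \<omega>' x0 xstar
          + 18 * c * \<sigma>\<^sup>2 * Q\<^sup>2 / (real b * \<mu>\<^sup>2 * (real T + 1))"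
proof -
  define C where "C = eff_dom \<Psi>"
  define \<psi> where "\<psi> = (\<lambda>z. real_of_ereal (\<Psi> z))"
  interpret M: prob_space M by (rule M)
  interpret P: prob_space P by (rule P(1))
  have space_P: "space P = \<Xi>"
    using sets_eq_imp_space_eq[OF P(2)] by (simp add: space_restrict_space)
  have L: "0 \<le> L"
  proof -
    \<comment> \<open>The sign of \<open>L\<close> is read off the smoothness bound at two distinct points.\<close>
    obtain s where "s \<in> \<Xi>" using P.not_empty space_P by auto
    then have "0 \<le> L * N (1 - 0)"
      using F_smooth[of s 1 0] dual_norm_nonneg[OF norm, of "F' 1 s - F' 0 s"] by linarith
    moreover have "0 < N 1"
      using norm is_norm_nonneg[OF norm, of 1] unfolding is_norm_def
      by (metis less_eq_real_def zero_neq_one)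
    ultimately show ?thesis by (simp add: zero_le_mult_iff)
  qed
  have f_smooth: "f z \<le> f u + f' u \<bullet> (z - u) + L / 2 * (N (z - u))\<^sup>2" for u z
  proof -
    have "f z \<le> (\<integral>s. F u s + F' u s \<bullet> (z - u) + L / 2 * (N (z - u))\<^sup>2 \<partial>P)"
      unfolding f
    proof (rule integral_mono)
      fix s assume "s \<in> space P"
      then show "F z s \<le> F u s + F' u s \<bullet> (z - u) + L / 2 * (N (z - u))\<^sup>2"
        by (intro descent_inequality[OF norm L] F_grad F_smooth) (simp_all add: space_P)
    qed (use F_integrable F'_integrable in auto)
    also have "\<dots> = f u + f' u \<bullet> (z - u) + L / 2 * (N (z - u))\<^sup>2"
      using F_integrable F'_integrable by (simp add: f f' P.prob_space)
    finally show ?thesis .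
  qed
  have f_gradient: "f u + f' u \<bullet> (z - u) \<le> f z" for u z
    by (rule convex_on_gradient_inequality[OF f_convex f_grad])
  have "is_arg_min (\<lambda>z. ereal (f z) + \<Psi> z + ereal 0) (\<lambda>_. True) xstar"
    using xstar by (simp flip: zero_ereal_def)
  note min_xstar = arg_min_in_eff_dom[OF Psi(1) this]
  have xstar_C: "xstar \<in> C" using min_xstar(1) by (simp add: C_def)
  have optimum: "f xstar + \<psi> xstar \<le> f z + \<psi> z" if "z \<in> C" for z
    using min_xstar(2)[of z] that by (simp add: C_def \<psi>_def)
  have a: "1 / \<gamma> k = 2 * L * (real \<tau>max + 1)\<^sup>2 + \<mu> / Q / 3 * (real k + real \<tau>max + 1)" for k
    using gamma(2)[of k] beta[of k] by (simp add: inverse_eq_divide mult.commute)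
  have dgf: "distance_generating N C \<omega> \<omega>'"
    unfolding C_def by (rule distance_generating_subset[OF omega(2,1)])
  interpret mirror_geometry N C \<psi> \<mu> \<omega> \<omega>'
  proof
    show "is_norm N" by (rule norm)
    show "convex C" "convex_on C \<psi>"
      unfolding C_def \<psi>_def by (rule convex_eff_dom[OF Psi(1,2)])+
    show "distance_generating N C \<omega> \<omega>'" by (rule dgf)
    show "0 \<le> \<mu>" using Psi_strong(1) by simp
    show "\<psi> u + s \<bullet> (z - u) + \<mu> / 2 * (N (z - u))\<^sup>2 \<le> \<psi> z"
      if "u \<in> C" "z \<in> C" "\<And>v. v \<in> C \<Longrightarrow> \<psi> u + s \<bullet> (v - u) \<le> \<psi> v" for u z s
      using that unfolding C_def \<psi>_def by (rule strongly_convex_fun_real[OF Psi(1) Psi_strong(2)])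
  qed
  obtain W G \<theta> where potential: "dual_potential N C \<omega> \<omega>' W G \<theta>"
    using exists_dual_potential[OF norm omega(2) omega(1) X_UNIV] unfolding C_def by blast
  interpret async_mirror_descent N C \<psi> \<mu> \<omega> \<omega>' M P "\<lambda>(i, k). \<xi> i k" b F' f' L \<sigma> W G \<theta> f Q
    \<tau>max d "\<lambda>k. 1 / \<gamma> k" x0 xstar x
  proof
    show "dual_potential N C \<omega> \<omega>' W G \<theta>" by (rule potential)
    show "M.indep_vars (\<lambda>_. P) (\<lambda>(i, k). \<xi> i k) ({1..b} \<times> UNIV)" by (rule samples_indep)
    show "distr M P ((\<lambda>(i, k). \<xi> i k) p) = P" if "p \<in> {1..b} \<times> UNIV" for p
      using that samples_distr by auto
    show "dual_norm N (F' u s - F' z s) \<le> L * N (u - z)" if "s \<in> space P" for s u z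
      using that by (intro F_smooth) (simp add: space_P)
    show "bregman \<omega> \<omega>' u z \<le> Q / 2 * (N (u - z))\<^sup>2" if "u \<in> C" "z \<in> C" for u z
      using Q(2) that unfolding C_def .
    show "x0 \<in> C" using x0 by (simp add: C_def)
    show "x 0 w = x0" if "w \<in> space M" for w
      using run[OF that] by (simp add: async_minibatch_run_def)
    show "mirror_step (1 / \<gamma> k) (batch_grad F' b (\<lambda>i. (\<lambda>(i, k). \<xi> i k) (i, k) w) (x (d k) w))
        (x k w) (x (Suc k) w)" if "w \<in> space M" for k w
    proof -
      let ?g = "batch_grad F' b (\<lambda>i. \<xi> i k w) (x (d k) w)"
      have "is_arg_min (\<lambda>z. ereal (?g \<bullet> z) + \<Psi> z + ereal (1 / \<gamma> k * bregman \<omega> \<omega>' (x k w) z))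
          (\<lambda>z. True) (x (Suc k) w)"
        using run[OF that] unfolding async_minibatch_run_def by blast
      from arg_min_in_eff_dom[OF Psi(1) this, folded C_def, folded \<psi>_def] show ?thesis
        unfolding mirror_step_def by (simp add: \<psi>_def)
    qed
    show "0 < Q" using Q(1) by simp
  qed (fact norm F'_integrable f' variance f_smooth f_gradient L Psi_strong(1) optimum xstar_C b delays a
      P(1))+
  have V: "0 \<le> D x0 xstar"
  proof -
    have "x0 \<in> C" using x0 by (simp add: C_def)
    then have "1 / 2 * (N (xstar - x0))\<^sup>2 \<le> D x0 xstar"
      by (rule bregman_lower_bound[OF dgf _ xstar_C])
    then show ?thesis using zero_le_power2[of "N (xstar - x0)"] by linarith
  qed
  show ?thesis
  proof (intro allI impI conjI)
    fix T :: nat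
    show "integrable M (\<lambda>w. (N (x T w - xstar))\<^sup>2)" by (rule square_distance_integrable)
    show "(\<integral>w. (N (x T w - xstar))\<^sup>2 \<partial>M)
        \<le> 2 * (6 * L * Q / \<mu> + 1)\<^sup>2 * (real \<tau>max + 1) ^ 4 / (real T + 1)\<^sup>2 * bregman \<omega> \<omega>' x0 xstar
          + 18 * c * \<sigma>\<^sup>2 * Q\<^sup>2 / (real b * \<mu>\<^sup>2 * (real T + 1))"
      using expected_square_distance[of T]
        rate_constants[where a = "\<lambda>k. 1 / \<gamma> k", OF L Psi_strong(1) _ c(2) b V a, of T \<sigma>] Q(1)
      by linarith
  qed
qed

end
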